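(* Let $q$ be a prime power, $C,R\in\mathbb{Q}$ with $C>0$, and for $n\in\mathbb{N}$ let $m=\lceil Cn+R\rceil$, $V\cong\mathbb{F}_q^n$, $W\cong\mathbb{F}_q^m$, $K=q^{m^2}/|\mathrm{GL}(m,q)|$. Then there exist constants $c>0$ and $n_0$ such that for all $n\ge n_0$, $$g((V\wedge V\oplus V)\otimes W)\le\left(q-1+q^{-cn^2}\right)\cdot\frac{q^{(\binom n2+n)m}}{|\mathrm{GL}(V)|\cdot|\mathrm{GL}(W)|}$$ and $$g(V\wedge V\oplus V,m)\le K\cdot\left(q-1+q^{-cn^2}\right)\cdot\frac{|\mathrm{Gr}(V\wedge V\oplus V,m)|}{|\mathrm{GL}(V)|}.$$
   Context: $\mathrm{GL}(V)$ acts on $V\wedge V\oplus V$ by $P\cdot(v_1\wedge v_2,v_3)=(Pv_1\wedge Pv_2,Pv_3)$ (extended linearly), and $\mathrm{GL}(V)\times\mathrm{GL}(W)$ acts on $(V\wedge V\oplus V)\otimes W$ by $(P,Q)\cdot(x\otimes w)=(P\cdot x)\otimes Qw$. $g((V\wedge V\oplus V)\otimes W)$ is the number of orbits of the latter action. $\mathrm{Gr}(V\wedge V\oplus V,m)$ is the set of $m$-dimensional subspaces of $V\wedge V\oplus V$, and $g(V\wedge V\oplus V,m)$ is the number of orbits of the induced $\mathrm{GL}(V)$-action on it. *)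

theory Defs
  imports
    Complex_Main
    "HOL-Library.Function_Algebras"
    "HOL-Library.Product_Plus"
    "HOL-Library.Cardinality"
    "HOL-Algebra.Group_Action"
    "Jordan_Normal_Form.Matrix"
begin

text \<open>
  The dimensions vary inside the statement, so all spaces are concrete subsets of fixed types, on
  which addition is pointwise. The finite field is a type \<open>'a\<close> of sort \<open>{field, finite}\<close>, so
  \<open>q = CARD('a)\<close>, which is automatically a prime power.
\<close>

definition scaleV :: "'a::field \<Rightarrow> (nat \<Rightarrow> 'a) \<Rightarrow> nat \<Rightarrow> 'a"
  where "scaleV c v = (\<lambda>i. c * v i)"

definition scaleM :: "'a::field \<Rightarrow> (nat \<Rightarrow> nat \<Rightarrow> 'a) \<Rightarrow> nat \<Rightarrow> nat \<Rightarrow> 'a"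
  where "scaleM c A = (\<lambda>i j. c * A i j)"

type_synonym 'a bivec = "(nat \<Rightarrow> nat \<Rightarrow> 'a) \<times> (nat \<Rightarrow> 'a)"

definition scaleX :: "'a::field \<Rightarrow> 'a bivec \<Rightarrow> 'a bivec"
  where "scaleX c = map_prod (scaleM c) (scaleV c)"

definition Fn :: "nat \<Rightarrow> (nat \<Rightarrow> 'a::field) set"
  where "Fn n = {v. \<forall>i\<ge>n. v i = 0}"

text \<open>
  With \<open>V \<otimes> V\<close> realised as matrices, \<open>v \<and> w\<close> is \<open>v w\<^sup>T - w v\<^sup>T\<close>. Its values span the
  alternating matrices (lemma \<open>ext2_eq\<close>: skew-symmetric with zero diagonal), which form the
  exterior square in every characteristic, 2 included (lemma \<open>ext2_universal\<close>).
\<close>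

definition wedge :: "(nat \<Rightarrow> 'a::field) \<Rightarrow> (nat \<Rightarrow> 'a) \<Rightarrow> nat \<Rightarrow> nat \<Rightarrow> 'a"
  where "wedge v w = (\<lambda>i j. v i * w j - w i * v j)"

definition ext2 :: "nat \<Rightarrow> (nat \<Rightarrow> nat \<Rightarrow> 'a::field) set"
  where "ext2 n = module.span scaleM {wedge v w | v w. v \<in> Fn n \<and> w \<in> Fn n}"

definition Xsp :: "nat \<Rightarrow> 'a::field bivec set"
  where "Xsp n = ext2 n \<times> Fn n"

text \<open>
  \<open>X \<otimes> W\<close> for \<open>W = F\<^sup>m\<close> is \<open>X\<^sup>m\<close>: the pure tensor \<open>x \<otimes> w\<close> has \<open>k\<close>-th entry \<open>w\<^sub>k x\<close>
  (lemma \<open>tensor_universal\<close>).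
\<close>

definition pure :: "'a::field bivec \<Rightarrow> (nat \<Rightarrow> 'a) \<Rightarrow> nat \<Rightarrow> 'a bivec"
  where "pure x w = (\<lambda>k. scaleX (w k) x)"

definition XW :: "nat \<Rightarrow> nat \<Rightarrow> (nat \<Rightarrow> 'a::field bivec) set"
  where "XW n m = {t. (\<forall>k<m. t k \<in> Xsp n) \<and> (\<forall>k\<ge>m. t k = 0)}"

definition Gr :: "nat \<Rightarrow> nat \<Rightarrow> 'a::field bivec set set"
  where "Gr n m =
    {U. module.subspace scaleX U \<and> U \<subseteq> Xsp n \<and> vector_space.dim scaleX U = m}"

definition GL :: "'a::field itself \<Rightarrow> nat \<Rightarrow> 'a mat monoid"
  where "GL ty n = units_of (ring_mat ty n ())"

definition actV :: "nat \<Rightarrow> 'a::field mat \<Rightarrow> (nat \<Rightarrow> 'a) \<Rightarrow> nat \<Rightarrow> 'a"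
  where "actV n P v = (\<lambda>i. if i < n then \<Sum>j<n. P $$ (i, j) * v j else 0)"

text \<open>
  \<open>A \<mapsto> P A P\<^sup>T\<close>, the linear map with \<open>v \<and> w \<mapsto> P v \<and> P w\<close> (lemma \<open>actM_wedge\<close>).
\<close>

definition actM :: "nat \<Rightarrow> 'a::field mat \<Rightarrow> (nat \<Rightarrow> nat \<Rightarrow> 'a) \<Rightarrow> nat \<Rightarrow> nat \<Rightarrow> 'a"
  where "actM n P A = (\<lambda>i j. if i < n \<and> j < n
    then \<Sum>k<n. \<Sum>l<n. P $$ (i, k) * A k l * P $$ (j, l) else 0)"

definition actX :: "nat \<Rightarrow> 'a::field mat \<Rightarrow> 'a bivec \<Rightarrow> 'a bivec"
  where "actX n P = map_prod (actM n P) (actV n P)"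

text \<open>The linear map with \<open>x \<otimes> w \<mapsto> P x \<otimes> Q w\<close> (lemma \<open>actXW_pure\<close>).\<close>

definition actXW :: "nat \<Rightarrow> nat \<Rightarrow> 'a::field mat \<times> 'a mat \<Rightarrow>
    (nat \<Rightarrow> 'a bivec) \<Rightarrow> nat \<Rightarrow> 'a bivec"
  where "actXW n m = (\<lambda>(P, Q) t k. if k < m
    then \<Sum>l<m. scaleX (Q $$ (k, l)) (actX n P (t l)) else 0)"

definition g_tensor :: "'a::field itself \<Rightarrow> nat \<Rightarrow> nat \<Rightarrow> nat"
  where "g_tensor ty n m =
    card (orbits (GL ty n \<times>\<times> GL ty m) (XW n m) (\<lambda>PQ. \<lambda>t\<in>XW n m. actXW n m PQ t))"

definition g_Gr :: "'a::field itself \<Rightarrow> nat \<Rightarrow> nat \<Rightarrow> nat"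
  where "g_Gr ty n m =
    card (orbits (GL ty n) (Gr n m) (\<lambda>P. \<lambda>U\<in>Gr n m. actX n P ` U))"

lemma vector_space_scaleV: "vector_space scaleV"
  by unfold_locales (auto simp: scaleV_def algebra_simps fun_eq_iff)

lemma vector_space_scaleM: "vector_space scaleM"
  by unfold_locales (auto simp: scaleM_def algebra_simps fun_eq_iff)

lemma vector_space_scaleX: "vector_space scaleX"
  by unfold_locales
    (auto simp: scaleX_def scaleM_def scaleV_def algebra_simps fun_eq_iff plus_prod_def)

interpretation VM: vector_space scaleM by (rule vector_space_scaleM)
interpretation VX: vector_space scaleX by (rule vector_space_scaleX)

definition unitv :: "nat \<Rightarrow> nat \<Rightarrow> 'a::field"
  where "unitv i = (\<lambda>k. if k = i then 1 else 0)"

lemma unitv_Fn: "i < n \<Longrightarrow> unitv i \<in> Fn n"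
  by (auto simp: unitv_def Fn_def)

lemma sum_fun_apply: "(sum f S) x = (\<Sum>s\<in>S. f s x)"
  for f :: "'i \<Rightarrow> 'x \<Rightarrow> 'y::comm_monoid_add"
  by (induction S rule: infinite_finite_induct) auto

definition alt :: "nat \<Rightarrow> (nat \<Rightarrow> nat \<Rightarrow> 'a::field) set"
  where "alt n = {A. (\<forall>i j. A i j + A j i = 0) \<and> (\<forall>i. A i i = 0) \<and>
    (\<forall>i j. n \<le> i \<or> n \<le> j \<longrightarrow> A i j = 0)}"

lemma alt_expand:
  assumes "A \<in> alt n"
  shows "A = (\<Sum>j<n. \<Sum>i<j. scaleM (A i j) (wedge (unitv i) (unitv j)))"
proof (intro ext)
  fix a b
  from assms have sk: "\<And>i j. A i j + A j i = 0" and d: "\<And>i. A i i = 0"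
    and z: "\<And>i j. n \<le> i \<or> n \<le> j \<Longrightarrow> A i j = 0" by (auto simp: alt_def)
  have R: "(\<Sum>j<n. \<Sum>i<j. scaleM (A i j) (wedge (unitv i) (unitv j))) a b
    = (\<Sum>j<n. \<Sum>i<j. (if i = a \<and> j = b then A i j else 0) -
        (if i = b \<and> j = a then A i j else 0))"
    unfolding sum_fun_apply
    by (intro sum.cong refl) (simp add: scaleM_def wedge_def unitv_def)
  have S: "(\<Sum>j<n. \<Sum>i<j. (if i = c \<and> j = e then A i j else 0)) =
      (if c < e \<and> e < n then A c e else 0)" for c e
  proof -
    have "(\<Sum>i<j. (if i = c \<and> j = e then A i j else 0)) =
      (if j = e then (if c < e then A c e else 0) else 0)" for j
      by (cases "j = e") simp_all
    then show ?thesis by simp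
  qed
  show "A a b = (\<Sum>j<n. \<Sum>i<j. scaleM (A i j) (wedge (unitv i) (unitv j))) a b"
    unfolding R sum_subtractf S
  proof (cases a b rule: linorder_cases)
    case less
    then show "A a b = (if a < b \<and> b < n then A a b else 0) - (if b < a \<and> a < n then A b a else 0)"
      using z[of a b] by (simp add: not_less)
  next
    case equal
    then show "A a b = (if a < b \<and> b < n then A a b else 0) - (if b < a \<and> a < n then A b a else 0)"
      using d[of b] by simp
  next
    case greater
    then show "A a b = (if a < b \<and> b < n then A a b else 0) - (if b < a \<and> a < n then A b a else 0)"
      using z[of a b] eq_neg_iff_add_eq_0[THEN iffD2, OF sk[of a b]] by (cases "a < n") simp_all
  qed
qed

lemma wedge_alt: "v \<in> Fn n \<Longrightarrow> w \<in> Fn n \<Longrightarrow> wedge v w \<in> alt n"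
  by (auto simp: alt_def wedge_def Fn_def)

lemma subspace_alt: "module.subspace scaleM (alt n)"
  unfolding VM.subspace_def
proof (intro conjI ballI allI)
  show "A + B \<in> alt n" if "A \<in> alt n" "B \<in> alt n" for A B :: "nat \<Rightarrow> nat \<Rightarrow> 'a"
    using that by (simp add: alt_def add.assoc add.left_commute[of "B _ _"])
  show "scaleM c A \<in> alt n" if "A \<in> alt n" for c and A :: "nat \<Rightarrow> nat \<Rightarrow> 'a"
    using that by (simp add: alt_def scaleM_def flip: distrib_left)
qed (simp add: alt_def)

lemma wedge_ext2: "v \<in> Fn n \<Longrightarrow> w \<in> Fn n \<Longrightarrow> wedge v w \<in> ext2 n"
  unfolding ext2_def by (rule VM.span_base) auto

lemma ext2_eq: "ext2 n = (alt n :: (nat \<Rightarrow> nat \<Rightarrow> 'a::field) set)"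
proof
  show "ext2 n \<subseteq> (alt n :: (nat \<Rightarrow> nat \<Rightarrow> 'a) set)"
    unfolding ext2_def by (rule VM.span_minimal) (auto simp: wedge_alt subspace_alt)
  show "(alt n :: (nat \<Rightarrow> nat \<Rightarrow> 'a) set) \<subseteq> ext2 n"
  proof
    fix A :: "nat \<Rightarrow> nat \<Rightarrow> 'a" assume A: "A \<in> alt n"
    have "(\<Sum>j<n. \<Sum>i<j. scaleM (A i j) (wedge (unitv i) (unitv j))) \<in> ext2 n"
      unfolding ext2_def
      by (rule VM.span_sum, rule VM.span_sum, rule VM.span_scale,
          rule wedge_ext2[unfolded ext2_def]; rule unitv_Fn; simp)
    then show "A \<in> ext2 n" using alt_expand[OF A] by simp
  qed
qed

lemma Fn_expand:
  assumes "v \<in> Fn n" shows "v = (\<Sum>i<n. scaleV (v i) (unitv i))"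
proof
  fix k
  have "(\<Sum>i<n. scaleV (v i) (unitv i)) k = (\<Sum>i<n. if i = k then v i else 0)"
    unfolding sum_fun_apply by (intro sum.cong refl) (simp add: scaleV_def unitv_def)
  then show "v k = (\<Sum>i<n. scaleV (v i) (unitv i)) k"
    using assms by (simp add: Fn_def not_less)
qed

lemma ext2_universal:
  fixes s :: "'a::field \<Rightarrow> 'z::ab_group_add \<Rightarrow> 'z" and b :: "(nat \<Rightarrow> 'a) \<Rightarrow> (nat \<Rightarrow> 'a) \<Rightarrow> 'z"
  assumes "vector_space s"
    and addl: "\<And>u v w. \<lbrakk>u \<in> Fn n; v \<in> Fn n; w \<in> Fn n\<rbrakk> \<Longrightarrow> b (u + v) w = b u w + b v w"
    and addr: "\<And>u v w. \<lbrakk>u \<in> Fn n; v \<in> Fn n; w \<in> Fn n\<rbrakk> \<Longrightarrow> b u (v + w) = b u v + b u w"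
    and scl: "\<And>c v w. \<lbrakk>v \<in> Fn n; w \<in> Fn n\<rbrakk> \<Longrightarrow> b (scaleV c v) w = s c (b v w)"
    and scr: "\<And>c v w. \<lbrakk>v \<in> Fn n; w \<in> Fn n\<rbrakk> \<Longrightarrow> b v (scaleV c w) = s c (b v w)"
    and altn: "\<And>v. v \<in> Fn n \<Longrightarrow> b v v = 0"
  shows "\<exists>f. Vector_Spaces.linear scaleM s f \<and>
      (\<forall>v\<in>Fn n. \<forall>w\<in>Fn n. f (wedge v w) = b v w) \<and>
      (\<forall>f'. Vector_Spaces.linear scaleM s f' \<and> (\<forall>v\<in>Fn n. \<forall>w\<in>Fn n. f' (wedge v w) = b v w)
        \<longrightarrow> (\<forall>A\<in>ext2 n. f' A = f A))"
proof -
  interpret Z: vector_space s by fact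
  interpret P: vector_space_pair scaleM s by unfold_locales
  let ?e = "unitv :: nat \<Rightarrow> nat \<Rightarrow> 'a"
  define f where "f A = (\<Sum>j<n. \<Sum>i<j. s (A i j) (b (?e i) (?e j)))" for A
  have F0: "(0 :: nat \<Rightarrow> 'a) \<in> Fn n" by (simp add: Fn_def)
  have Fa: "u + v \<in> Fn n" if "u \<in> Fn n" "v \<in> Fn n" for u v :: "nat \<Rightarrow> 'a"
    using that by (auto simp: Fn_def)
  have Fs: "scaleV c v \<in> Fn n" if "v \<in> Fn n" for c and v :: "nat \<Rightarrow> 'a"
    using that by (auto simp: Fn_def scaleV_def)
  have lin: "Vector_Spaces.linear scaleM s f"
    unfolding Vector_Spaces.linear_iff
  proof (intro conjI allI)
    show "f (x + y) = f x + f y" for x y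
      by (simp add: f_def Z.scale_left_distrib sum.distrib)
    show "f (scaleM r x) = s r (f x)" for r x
      by (simp add: f_def scaleM_def Z.scale_sum_right)
  qed (fact vector_space_scaleM \<open>vector_space s\<close>)+
  have b0l: "b 0 w = 0" if "w \<in> Fn n" for w
    using addl[OF F0 F0 that] by simp
  have b0r: "b w 0 = 0" if "w \<in> Fn n" for w
    using addr[OF that F0 F0] by simp
  have suml: "finite S \<Longrightarrow> (\<And>i. i \<in> S \<Longrightarrow> g i \<in> Fn n) \<Longrightarrow>
      sum g S \<in> Fn n \<and> b (sum g S) w = (\<Sum>i\<in>S. b (g i) w)"
    if "w \<in> Fn n" for w and S :: "nat set" and g
    by (induction S rule: finite_induct) (use that in \<open>auto simp: F0 b0l addl Fa\<close>)
  have sumr: "finite S \<Longrightarrow> (\<And>i. i \<in> S \<Longrightarrow> g i \<in> Fn n) \<Longrightarrow>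
      sum g S \<in> Fn n \<and> b w (sum g S) = (\<Sum>i\<in>S. b w (g i))"
    if "w \<in> Fn n" for w and S :: "nat set" and g
    by (induction S rule: finite_induct) (use that in \<open>auto simp: F0 b0r addr Fa\<close>)
  have expand: "b v w = (\<Sum>i<n. \<Sum>j<n. s (v i * w j) (b (?e i) (?e j)))"
    if v: "v \<in> Fn n" and w: "w \<in> Fn n" for v w
  proof -
    have "b v w = b (\<Sum>i<n. scaleV (v i) (?e i)) w" using Fn_expand[OF v] by simp
    also have "\<dots> = (\<Sum>i<n. b (scaleV (v i) (?e i)) w)"
      using suml[OF w, of "{..<n}" "\<lambda>i. scaleV (v i) (?e i)"] by (simp add: Fs unitv_Fn)
    also have "\<dots> = (\<Sum>i<n. s (v i) (b (?e i) w))"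
      by (intro sum.cong refl scl w) (simp add: unitv_Fn)
    also have "\<dots> = (\<Sum>i<n. s (v i) (\<Sum>j<n. s (w j) (b (?e i) (?e j))))"
    proof (intro sum.cong refl arg_cong[where f = "s _"])
      fix i assume "i \<in> {..<n}"
      then have i: "?e i \<in> Fn n" by (simp add: unitv_Fn)
      have "b (?e i) w = b (?e i) (\<Sum>j<n. scaleV (w j) (?e j))" using Fn_expand[OF w] by simp
      also have "\<dots> = (\<Sum>j<n. b (?e i) (scaleV (w j) (?e j)))"
        using sumr[OF i, of "{..<n}" "\<lambda>i. scaleV (w i) (?e i)"] by (simp add: Fs unitv_Fn)
      also have "\<dots> = (\<Sum>j<n. s (w j) (b (?e i) (?e j)))"
        by (intro sum.cong refl scr i) (simp add: unitv_Fn)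
      finally show "b (?e i) w = (\<Sum>j<n. s (w j) (b (?e i) (?e j)))" .
    qed
    finally show ?thesis by (simp add: Z.scale_sum_right)
  qed
  have skew: "b v w = - b w v" if "v \<in> Fn n" "w \<in> Fn n" for v w
  proof -
    have "b (v + w) (v + w) = (b v v + b w v) + (b v w + b w w)"
      using that by (simp only: addl addr Fa)
    then have "b v w + b w v = b (v + w) (v + w)"
      using that by (simp only: altn) (simp add: add.commute)
    also have "\<dots> = 0" by (rule altn[OF Fa[OF that]])
    finally show ?thesis by (simp add: eq_neg_iff_add_eq_0)
  qed
  have tri: "(\<Sum>i<k. \<Sum>j<k. h i j) = (\<Sum>j<k. \<Sum>i<j. h i j + h j i) + (\<Sum>j<k. h j j)"
    for k and h :: "nat \<Rightarrow> nat \<Rightarrow> 'z"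
    by (induction k) (simp_all add: sum.distrib algebra_simps)
  have fw: "f (wedge v w) = b v w" if "v \<in> Fn n" "w \<in> Fn n" for v w
  proof -
    have "b v w = (\<Sum>j<n. \<Sum>i<j. s (v i * w j) (b (?e i) (?e j)) + s (v j * w i) (b (?e j) (?e i)))"
      unfolding expand[OF that] tri by (simp add: altn unitv_Fn)
    also have "\<dots> = f (wedge v w)"
      unfolding f_def
    proof (intro sum.cong refl)
      fix i j assume "j \<in> {..<n}" "i \<in> {..<j}"
      then have "b (?e j) (?e i) = - b (?e i) (?e j)" by (intro skew unitv_Fn) auto
      then show "s (v i * w j) (b (?e i) (?e j)) + s (v j * w i) (b (?e j) (?e i))
        = s (wedge v w i j) (b (?e i) (?e j))"
        by (simp add: wedge_def Z.scale_left_diff_distrib mult.commute)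
    qed
    finally show ?thesis by simp
  qed
  have uniq: "f' A = f A" if "Vector_Spaces.linear scaleM s f'"
    "\<forall>v\<in>Fn n. \<forall>w\<in>Fn n. f' (wedge v w) = b v w" "A \<in> ext2 n" for f' A
    using that(3) unfolding ext2_def
    by (rule P.linear_eq_on[OF that(1) lin]) (use that(2) fw in auto)
  show ?thesis using lin fw uniq by blast
qed

lemma subspace_Xsp: "module.subspace scaleX (Xsp n)"
  unfolding VX.subspace_def
  using subspace_alt[of n] unfolding VM.subspace_def
  by (auto simp: Xsp_def ext2_eq Fn_def scaleX_def scaleV_def plus_prod_def zero_prod_def)

lemma tensor_universal:
  fixes s :: "'a::field \<Rightarrow> 'z::ab_group_add \<Rightarrow> 'z" and b :: "'a bivec \<Rightarrow> (nat \<Rightarrow> 'a) \<Rightarrow> 'z"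
  assumes "vector_space s"
    and addl: "\<And>x y w. \<lbrakk>x \<in> Xsp n; y \<in> Xsp n; w \<in> Fn m\<rbrakk> \<Longrightarrow> b (x + y) w = b x w + b y w"
    and addr: "\<And>x v w. \<lbrakk>x \<in> Xsp n; v \<in> Fn m; w \<in> Fn m\<rbrakk> \<Longrightarrow> b x (v + w) = b x v + b x w"
    and scl: "\<And>c x w. \<lbrakk>x \<in> Xsp n; w \<in> Fn m\<rbrakk> \<Longrightarrow> b (scaleX c x) w = s c (b x w)"
    and scr: "\<And>c x w. \<lbrakk>x \<in> Xsp n; w \<in> Fn m\<rbrakk> \<Longrightarrow> b x (scaleV c w) = s c (b x w)"
  defines "ext_of f \<equiv> (\<forall>t\<in>XW n m. \<forall>u\<in>XW n m. f (t + u) = f t + f u) \<and>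
      (\<forall>c. \<forall>t\<in>XW n m. f (\<lambda>k. scaleX c (t k)) = s c (f t)) \<and>
      (\<forall>x\<in>Xsp n. \<forall>w\<in>Fn m. f (pure x w) = b x w)"
  shows "\<exists>f. ext_of f \<and> (\<forall>f'. ext_of f' \<longrightarrow> (\<forall>t\<in>XW n m. f' t = f t))"
proof -
  interpret Z: vector_space s by fact
  let ?e = "unitv :: nat \<Rightarrow> nat \<Rightarrow> 'a"
  define f where "f t = (\<Sum>k<m. b (t k) (?e k))" for t
  have F0: "(0 :: nat \<Rightarrow> 'a) \<in> Fn m" by (simp add: Fn_def)
  have Fa: "u + v \<in> Fn m" if "u \<in> Fn m" "v \<in> Fn m" for u v :: "nat \<Rightarrow> 'a"
    using that by (auto simp: Fn_def)
  have Fs: "scaleV c v \<in> Fn m" if "v \<in> Fn m" for c and v :: "nat \<Rightarrow> 'a"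
    using that by (auto simp: Fn_def scaleV_def)
  have b0r: "b x 0 = 0" if "x \<in> Xsp n" for x
    using addr[OF that F0 F0] by simp
  have sumr: "finite S \<Longrightarrow> (\<And>i. i \<in> S \<Longrightarrow> g i \<in> Fn m) \<Longrightarrow>
      sum g S \<in> Fn m \<and> b x (sum g S) = (\<Sum>i\<in>S. b x (g i))"
    if "x \<in> Xsp n" for x and S :: "nat set" and g
    by (induction S rule: finite_induct) (use that in \<open>auto simp: F0 b0r addr Fa\<close>)
  have fp: "f (pure x w) = b x w" if x: "x \<in> Xsp n" and w: "w \<in> Fn m" for x w
  proof -
    have "b x w = b x (\<Sum>k<m. scaleV (w k) (?e k))" using Fn_expand[OF w] by simp
    also have "\<dots> = (\<Sum>k<m. b x (scaleV (w k) (?e k)))"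
      using sumr[OF x, of "{..<m}" "\<lambda>k. scaleV (w k) (?e k)"] by (simp add: Fs unitv_Fn)
    also have "\<dots> = f (pure x w)"
      unfolding f_def pure_def by (intro sum.cong refl) (simp add: x scl scr unitv_Fn)
    finally show ?thesis by simp
  qed
  have ext: "ext_of f"
    unfolding ext_of_def
  proof (intro conjI ballI allI)
    show "f (t + u) = f t + f u" if "t \<in> XW n m" "u \<in> XW n m" for t u
      using that by (auto simp: f_def XW_def addl unitv_Fn simp flip: sum.distrib intro!: sum.cong)
    show "f (\<lambda>k. scaleX c (t k)) = s c (f t)" if "t \<in> XW n m" for c t
      using that by (auto simp: f_def XW_def scl unitv_Fn Z.scale_sum_right intro!: sum.cong)
  qed (rule fp)
  have pXW: "pure x w \<in> XW n m" if "x \<in> Xsp n" "w \<in> Fn m" for x w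
    using that VX.subspace_scale[OF subspace_Xsp, of x n] by (simp add: pure_def XW_def Fn_def)
  have XW0: "0 \<in> XW n m"
    using VX.subspace_0[OF subspace_Xsp] by (auto simp: XW_def)
  have XWa: "t + u \<in> XW n m" if "t \<in> XW n m" "u \<in> XW n m" for t u :: "nat \<Rightarrow> 'a bivec"
    using that by (simp add: XW_def VX.subspace_add[OF subspace_Xsp])
  have uniq: "f' t = f t" if f': "ext_of f'" and t: "t \<in> XW n m" for f' t
  proof -
    have add: "f' (t + u) = f' t + f' u" if "t \<in> XW n m" "u \<in> XW n m" for t u
      using f' that by (simp add: ext_of_def)
    have z: "f' 0 = 0" using add[OF XW0 XW0] by simp
    have ex: "t = (\<Sum>k<m. pure (t k) (?e k))"
    proof
      fix l
      have "(\<Sum>k<m. pure (t k) (?e k)) l = (\<Sum>k<m. if k = l then t k else 0)"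
        unfolding sum_fun_apply by (intro sum.cong refl) (auto simp: pure_def unitv_def)
      then show "t l = (\<Sum>k<m. pure (t k) (?e k)) l"
        using t by (auto simp: XW_def not_less)
    qed
    have sm: "finite S \<Longrightarrow> (\<And>i. i \<in> S \<Longrightarrow> g i \<in> XW n m) \<Longrightarrow>
      sum g S \<in> XW n m \<and> f' (sum g S) = (\<Sum>i\<in>S. f' (g i))" for S :: "nat set" and g
      by (induction S rule: finite_induct) (auto simp: XW0 z add XWa)
    have tk: "t k \<in> Xsp n" if "k < m" for k using t that by (simp add: XW_def)
    have "f' t = f' (\<Sum>k<m. pure (t k) (?e k))" using ex by simp
    also have "\<dots> = (\<Sum>k<m. f' (pure (t k) (?e k)))"
      using sm[of "{..<m}" "\<lambda>k. pure (t k) (?e k)"] by (simp add: pXW tk unitv_Fn)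
    also have "\<dots> = f t"
      unfolding f_def using f' by (intro sum.cong refl) (simp add: ext_of_def tk unitv_Fn)
    finally show ?thesis .
  qed
  show ?thesis using ext uniq by blast
qed

lemma linear_actV: "Vector_Spaces.linear scaleV scaleV (actV n P)"
  unfolding Vector_Spaces.linear_iff
proof (intro conjI allI vector_space_scaleV)
  show "actV n P (x + y) = actV n P x + actV n P y" for x y
    by (auto simp: actV_def fun_eq_iff distrib_left sum.distrib)
  show "actV n P (scaleV c x) = scaleV c (actV n P x)" for c x
    by (auto simp: actV_def scaleV_def fun_eq_iff sum_distrib_left mult.left_commute)
qed

lemma linear_actM: "Vector_Spaces.linear scaleM scaleM (actM n P)"
  unfolding Vector_Spaces.linear_iff
proof (intro conjI allI vector_space_scaleM)
  show "actM n P (x + y) = actM n P x + actM n P y" for x y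
    by (auto simp: actM_def fun_eq_iff distrib_left distrib_right sum.distrib)
  show "actM n P (scaleM c x) = scaleM c (actM n P x)" for c x
    by (auto simp: actM_def scaleM_def fun_eq_iff sum_distrib_left mult_ac)
qed

lemma actM_wedge: "actM n P (wedge v w) = wedge (actV n P v) (actV n P w)"
proof (intro ext)
  fix i j
  have e: "(\<Sum>k<n. \<Sum>l<n. P $$ (i, k) * (v k * w l - w k * v l) * P $$ (j, l))
    = (\<Sum>k<n. P $$ (i, k) * v k) * (\<Sum>l<n. P $$ (j, l) * w l)
      - (\<Sum>k<n. P $$ (i, k) * w k) * (\<Sum>l<n. P $$ (j, l) * v l)"
    unfolding sum_product sum_subtractf[symmetric]
    by (intro sum.cong refl) (simp add: algebra_simps)
  show "actM n P (wedge v w) i j = wedge (actV n P v) (actV n P w) i j"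
    using e by (simp add: actM_def actV_def wedge_def)
qed

lemma linear_actX: "Vector_Spaces.linear scaleX scaleX (actX n P)"
  using linear_actM[of n P] linear_actV[of n P] vector_space_scaleX
  unfolding Vector_Spaces.linear_iff by (auto simp: actX_def scaleX_def plus_prod_def)

lemma actV_Fn: "actV n P v \<in> Fn n"
  by (simp add: actV_def Fn_def)

lemma actM_ext2:
  assumes "A \<in> ext2 n" shows "actM n P A \<in> ext2 n"
proof -
  interpret L: Vector_Spaces.linear scaleM scaleM "actM n P" by (rule linear_actM)
  have "ext2 n \<subseteq> {A. actM n P A \<in> ext2 n}"
    unfolding ext2_def
  proof (rule VM.span_minimal)
    show "{wedge v w |v w. v \<in> Fn n \<and> w \<in> Fn n}
      \<subseteq> {A. actM n P A \<in> VM.span {wedge v w |v w. v \<in> Fn n \<and> w \<in> Fn n}}"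
      by (auto simp: actM_wedge simp flip: ext2_def intro!: wedge_ext2 actV_Fn)
    show "VM.subspace {A. actM n P A \<in> VM.span {wedge v w |v w. v \<in> Fn n \<and> w \<in> Fn n}}"
      by (simp add: VM.subspace_def L.add L.scale L.zero VM.span_add VM.span_scale VM.span_zero)
  qed
  then show ?thesis using assms by auto
qed

lemma actX_Xsp: "x \<in> Xsp n \<Longrightarrow> actX n P x \<in> Xsp n"
  by (auto simp: Xsp_def actX_def actM_ext2 actV_Fn)

lemma actXW_XW: "t \<in> XW n m \<Longrightarrow> actXW n m PQ t \<in> XW n m"
  by (cases PQ)
    (auto simp: XW_def actXW_def intro!: VX.subspace_sum[OF subspace_Xsp]
      VX.subspace_scale[OF subspace_Xsp] actX_Xsp)

lemma actXW_pure: "actXW n m (P, Q) (pure x w) = pure (actX n P x) (actV m Q w)"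
proof -
  interpret L: Vector_Spaces.linear scaleX scaleX "actX n P" by (rule linear_actX)
  show ?thesis
    by (simp add: fun_eq_iff actXW_def pure_def actV_def L.scale VX.scale_sum_left)
qed

lemma actXW_add: "actXW n m PQ (t + u) = actXW n m PQ t + actXW n m PQ u"
proof (cases PQ)
  case (Pair P Q)
  interpret L: Vector_Spaces.linear scaleX scaleX "actX n P" by (rule linear_actX)
  show ?thesis
    by (simp add: Pair fun_eq_iff actXW_def L.add VX.scale_right_distrib sum.distrib)
qed

lemma actXW_scale:
  "actXW n m PQ (\<lambda>k. scaleX c (t k)) = (\<lambda>k. scaleX c (actXW n m PQ t k))"
proof (cases PQ)
  case (Pair P Q)
  interpret L: Vector_Spaces.linear scaleX scaleX "actX n P" by (rule linear_actX)
  show ?thesis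
    by (simp add: Pair fun_eq_iff actXW_def L.scale VX.scale_sum_right mult.commute)
qed

lemma group_GL: "group (GL (ty :: 'a::field itself) n)"
proof -
  interpret ring "ring_mat ty n ()"
    using ring_mat[of n "()", where 'a = 'a] by (simp add: ring_mat_def)
  show ?thesis unfolding GL_def by (rule units_group)
qed

lemma GL_simps:
  "P \<in> carrier (GL ty n) \<Longrightarrow> P \<in> carrier_mat n n"
  "monoid.mult (GL ty n) = (*)" "monoid.one (GL ty n) = 1\<^sub>m n"
  by (auto simp: GL_def units_of_def Units_def ring_mat_def)

lemma mult_entry:
  assumes "P \<in> carrier_mat n n" "Q \<in> carrier_mat n n" "i < n" "j < n"
  shows "(P * Q) $$ (i, j) = (\<Sum>k<n. P $$ (i, k) * Q $$ (k, j))"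
  using assms by (simp add: scalar_prod_def lessThan_atLeast0)

lemma actV_mult:
  assumes "P \<in> carrier_mat n n" "Q \<in> carrier_mat n n"
  shows "actV n (P * Q) v = actV n P (actV n Q v)"
proof
  fix i
  have "(\<Sum>j<n. (\<Sum>k<n. P $$ (i, k) * Q $$ (k, j)) * v j)
    = (\<Sum>k<n. P $$ (i, k) * (\<Sum>j<n. Q $$ (k, j) * v j))"
    unfolding sum_distrib_left sum_distrib_right by (subst sum.swap) (simp add: mult.assoc)
  moreover have "(\<Sum>j<n. (P * Q) $$ (i, j) * v j)
    = (\<Sum>j<n. (\<Sum>k<n. P $$ (i, k) * Q $$ (k, j)) * v j)" if "i < n"
    by (intro sum.cong refl) (use that in \<open>simp add: mult_entry[OF assms] del: index_mult_mat\<close>)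
  ultimately show "actV n (P * Q) v i = actV n P (actV n Q v) i"
    by (simp add: actV_def del: index_mult_mat)
qed

lemma actV_one: "v \<in> Fn n \<Longrightarrow> actV n (1\<^sub>m n) v = v"
proof
  fix i assume v: "v \<in> Fn n"
  have "(\<Sum>j<n. 1\<^sub>m n $$ (i, j) * v j) = (\<Sum>j<n. if i = j then v j else 0)" if "i < n"
    using that by (intro sum.cong refl) simp
  then show "actV n (1\<^sub>m n) v i = v i"
    using v by (simp add: actV_def Fn_def not_less)
qed

lemma linear_ext2_eqI:
  assumes "Vector_Spaces.linear scaleM scaleM f" "Vector_Spaces.linear scaleM scaleM g"
    and "\<And>v w. v \<in> Fn n \<Longrightarrow> w \<in> Fn n \<Longrightarrow> f (wedge v w) = g (wedge v w)"
    and "A \<in> ext2 n"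
  shows "f A = g A"
proof -
  interpret P: vector_space_pair scaleM scaleM by unfold_locales
  show ?thesis
    using assms(4) unfolding ext2_def
    by (rule P.linear_eq_on[OF assms(1,2)]) (use assms(3) in auto)
qed

lemma actM_mult:
  assumes "P \<in> carrier_mat n n" "Q \<in> carrier_mat n n" "A \<in> ext2 n"
  shows "actM n (P * Q) A = actM n P (actM n Q A)"
proof -
  have "Vector_Spaces.linear scaleM scaleM (\<lambda>A. actM n P (actM n Q A))"
    using linear_actM[of n P] linear_actM[of n Q] by (simp add: Vector_Spaces.linear_iff)
  from linear_ext2_eqI[OF linear_actM this _ assms(3)] show ?thesis
    by (simp add: actM_wedge actV_mult[OF assms(1,2)])
qed

lemma actM_one:
  assumes "A \<in> ext2 n"
  shows "actM n (1\<^sub>m n) A = A"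
proof -
  have "Vector_Spaces.linear scaleM scaleM (\<lambda>A. A)"
    by (simp add: Vector_Spaces.linear_iff vector_space_scaleM)
  from linear_ext2_eqI[OF linear_actM this _ assms] show ?thesis
    by (simp add: actM_wedge actV_one)
qed

lemma actX_mult:
  assumes "P \<in> carrier_mat n n" "Q \<in> carrier_mat n n" "x \<in> Xsp n"
  shows "actX n (P * Q) x = actX n P (actX n Q x)"
  using assms by (auto simp: actX_def Xsp_def actV_mult actM_mult)

lemma actX_one: "x \<in> Xsp n \<Longrightarrow> actX n (1\<^sub>m n) x = x"
  by (auto simp: actX_def Xsp_def actV_one actM_one)

lemma actXW_mult:
  assumes P: "P \<in> carrier_mat n n" "P' \<in> carrier_mat n n"
    and Q: "Q \<in> carrier_mat m m" "Q' \<in> carrier_mat m m" and t: "t \<in> XW n m"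
  shows "actXW n m (P * P', Q * Q') t = actXW n m (P, Q) (actXW n m (P', Q') t)"
proof
  fix k
  interpret L: Vector_Spaces.linear scaleX scaleX "actX n P" by (rule linear_actX)
  have tl: "t l \<in> Xsp n" if "l < m" for l using t that by (simp add: XW_def)
  have "(\<Sum>l<m. scaleX ((Q * Q') $$ (k, l)) (actX n (P * P') (t l)))
    = (\<Sum>r<m. scaleX (Q $$ (k, r))
        (actX n P (\<Sum>l<m. scaleX (Q' $$ (r, l)) (actX n P' (t l)))))" if k: "k < m"
  proof -
    have "(\<Sum>l<m. scaleX ((Q * Q') $$ (k, l)) (actX n (P * P') (t l)))
      = (\<Sum>l<m. \<Sum>r<m. scaleX (Q $$ (k, r) * Q' $$ (r, l)) (actX n P (actX n P' (t l))))"
      by (intro sum.cong refl)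
        (simp add: mult_entry[OF Q k] actX_mult[OF P tl] VX.scale_sum_left del: index_mult_mat)
    also have "\<dots> = (\<Sum>r<m. \<Sum>l<m. scaleX (Q $$ (k, r) * Q' $$ (r, l)) (actX n P (actX n P' (t l))))"
      by (rule sum.swap)
    finally show ?thesis by (simp add: L.sum L.scale VX.scale_sum_right)
  qed
  then show "actXW n m (P * P', Q * Q') t k = actXW n m (P, Q) (actXW n m (P', Q') t) k"
    by (simp add: actXW_def)
qed

lemma actXW_one:
  assumes t: "t \<in> XW n m" shows "actXW n m (1\<^sub>m n, 1\<^sub>m m) t = t"
proof
  fix k
  have "(\<Sum>l<m. scaleX (1\<^sub>m m $$ (k, l)) (actX n (1\<^sub>m n) (t l)))
    = (\<Sum>l<m. if k = l then t l else 0)" if "k < m"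
    using that t by (intro sum.cong refl) (auto simp: actX_one XW_def)
  then show "actXW n m (1\<^sub>m n, 1\<^sub>m m) t k = t k"
    using t by (simp add: actXW_def XW_def not_less)
qed

lemma group_actionI:
  assumes "group G"
    and cl: "\<And>g x. \<lbrakk>g \<in> carrier G; x \<in> E\<rbrakk> \<Longrightarrow> a g x \<in> E"
    and mul: "\<And>g h x. \<lbrakk>g \<in> carrier G; h \<in> carrier G; x \<in> E\<rbrakk> \<Longrightarrow> a (g \<otimes>\<^bsub>G\<^esub> h) x = a g (a h x)"
    and one: "\<And>x. x \<in> E \<Longrightarrow> a \<one>\<^bsub>G\<^esub> x = x"
  shows "group_action G E (\<lambda>g. \<lambda>x\<in>E. a g x)"
proof -
  interpret G: group G by fact
  have bij: "(\<lambda>x\<in>E. a g x) \<in> Bij E" if g: "g \<in> carrier G" for g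
  proof -
    have "bij_betw (a g) E E"
      by (rule bij_betw_byWitness[where f' = "a (inv\<^bsub>G\<^esub> g)"])
        (use g in \<open>auto simp: cl one simp flip: mul\<close>)
    then show ?thesis by (simp add: Bij_def)
  qed
  show ?thesis
  proof (intro group_action.intro group_hom.intro group_hom_axioms.intro homI)
    fix g h assume "g \<in> carrier G" "h \<in> carrier G"
    then show "(\<lambda>x\<in>E. a (g \<otimes>\<^bsub>G\<^esub> h) x) = (\<lambda>x\<in>E. a g x) \<otimes>\<^bsub>BijGroup E\<^esub> (\<lambda>x\<in>E. a h x)"
      using bij[of g] bij[of h] by (auto simp: BijGroup_def compose_def mul cl fun_eq_iff)
  next
    show "(\<lambda>x\<in>E. a g x) \<in> carrier (BijGroup E)" if "g \<in> carrier G" for g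
      using bij[OF that] by (simp add: BijGroup_def)
  qed (rule assms(1) group_BijGroup)+
qed

lemma group_action_XW:
  "group_action (GL ty n \<times>\<times> GL ty m) (XW n m) (\<lambda>PQ. \<lambda>t\<in>XW n m. actXW n m PQ t)"
  by (rule group_actionI)
    (auto simp: DirProd_group group_GL actXW_XW GL_simps actXW_one
      intro!: actXW_mult dest: GL_simps(1))

lemma actX_image_Gr:
  assumes P: "P \<in> carrier (GL ty n)" and U: "U \<in> Gr n m"
  shows "actX n P ` U \<in> Gr n m"
proof -
  interpret G: group "GL ty n" by (rule group_GL)
  interpret L: Vector_Spaces.linear scaleX scaleX "actX n P" by (rule linear_actX)
  interpret PX: vector_space_pair scaleX scaleX by unfold_locales
  from U have sub: "VX.subspace U" and UX: "U \<subseteq> Xsp n" and d: "VX.dim U = m"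
    by (auto simp: Gr_def)
  have "actX n (inv\<^bsub>GL ty n\<^esub> P) (actX n P x) = x" if "x \<in> Xsp n" for x
    using actX_mult[OF GL_simps(1)[OF G.inv_closed[OF P]] GL_simps(1)[OF P] that]
      G.l_inv[OF P] actX_one[OF that] by (simp add: GL_simps)
  then have "inj_on (actX n P) (Xsp n)" by (rule inj_on_inverseI)
  then have inj: "inj_on (actX n P) U" using UX by (rule inj_on_subset)
  obtain B where B: "B \<subseteq> U" "VX.independent B" "U \<subseteq> VX.span B" "card B = VX.dim U"
    by (rule VX.basis_exists)
  have sB: "VX.span B = U" using B(1,3) VX.span_minimal[OF B(1) sub] by auto
  have "VX.independent (actX n P ` B)"
    using B(2) inj sB by (intro PX.linear_independent_injective_image linear_actX) auto
  moreover have "VX.span (actX n P ` B) = VX.span (actX n P ` U)"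
    using L.span_image[of B] L.subspace_image[OF sub] sB by (metis VX.span_eq_iff)
  moreover have "card (actX n P ` B) = m"
    using card_image[OF inj_on_subset[OF inj B(1)]] B(4) d by simp
  ultimately have "VX.dim (actX n P ` U) = m"
    using VX.dim_eq_card by metis
  then show ?thesis
    using L.subspace_image[OF sub] UX by (auto simp: Gr_def actX_Xsp)
qed

lemma group_action_Gr:
  fixes ty :: "'a::field itself"
  shows "group_action (GL ty n) (Gr n m) (\<lambda>P. \<lambda>U\<in>Gr n m. actX n P ` U)"
proof (rule group_actionI)
  fix P Q and U :: "'a bivec set" assume "P \<in> carrier (GL ty n)" "Q \<in> carrier (GL ty n)" "U \<in> Gr n m"
  then show "actX n (P \<otimes>\<^bsub>GL ty n\<^esub> Q) ` U = actX n P ` actX n Q ` U"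
    unfolding image_image GL_simps
    by (intro image_cong refl actX_mult) (auto simp: Gr_def dest: GL_simps(1))
next
  fix U :: "'a bivec set" assume "U \<in> Gr n m"
  then have "actX n (1\<^sub>m n) ` U = (\<lambda>x. x) ` U"
    by (intro image_cong refl actX_one) (auto simp: Gr_def)
  then show "actX n \<one>\<^bsub>GL ty n\<^esub> ` U = U" by (simp add: GL_simps)
qed (simp_all add: group_GL actX_image_Gr)

end

theory Submission
  imports Defs
begin

text \<open>
  By Burnside's lemma \<open>g((V \<and> V \<oplus> V) \<otimes> W) \<cdot> |GL(V)| \<cdot> |GL(W)|\<close> is the sum of \<open>|Fix(P, Q)|\<close>. Write \<open>q\<close> to
  the power \<open>dim (X \<otimes> W) - loss\<close> for \<open>|Fix(P, Q)|\<close>; only the identity has loss \<open>0\<close>. If there are \<open>k\<close>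
  vectors \<open>f\<close> such that these and their images \<open>S f\<close> under \<open>S = P\<^sup>T\<close> (or \<open>S = Q\<^sup>T\<close>) are independent, then
  the loss is of order \<open>k n\<^sup>2\<close>. For a large constant \<open>k = K\<close> this beats the number \<open>q ^ O(n\<^sup>2)\<close> of all
  group elements. If there are no \<open>K\<close> such vectors, then \<open>S\<close> differs from a scalar by a map of rank at most
  \<open>2 K\<close>. There are only \<open>q ^ O(n)\<close> pairs for which this holds on both sides, and a nonidentity pair
  still has loss of order at least \<open>n\<^sup>2\<close>: with \<open>k = 1\<close> if \<open>P\<close> or \<open>Q\<close> is not scalar, and otherwise because
  scalars \<open>a, b\<close> act on the two summands by \<open>a\<^sup>2 b\<close> and \<open>a b\<close>. The Grassmannian bound follows since an orbit
  of subspaces is determined by the orbit of a spanning tuple, and \<open>|Gr| \<ge> q ^ (m (N - m))\<close> by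
  counting graphs of linear maps.
\<close>

section \<open>Cardinalities of spans and Grassmannians\<close>

interpretation VV: vector_space scaleV by (rule vector_space_scaleV)

text \<open>Extensional coefficient functions make the parametrisation of the span finite and, for
  independent \<open>B\<close>, injective.\<close>

lemma span_eq_image_PiE:
  fixes s :: "'a::field \<Rightarrow> 'b::ab_group_add \<Rightarrow> 'b"
  assumes "vector_space s" "finite B"
  shows "module.span s B = (\<lambda>u. \<Sum>v\<in>B. s (u v) v) ` (B \<rightarrow>\<^sub>E UNIV)"
proof -
  interpret vector_space s by fact
  let ?f = "\<lambda>u. \<Sum>v\<in>B. s (u v) v"
  have "?f u \<in> ?f ` (B \<rightarrow>\<^sub>E UNIV)" for u
    by (rule image_eqI[where x = "restrict u B"]) (auto intro: sum.cong)
  then show ?thesis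
    using span_finite[OF assms(2)] by auto
qed

lemma card_span_independent:
  fixes s :: "'a::{field,finite} \<Rightarrow> 'b::ab_group_add \<Rightarrow> 'b"
  assumes "vector_space s" "finite B" "\<not> module.dependent s B"
  shows "card (module.span s B) = CARD('a) ^ card B"
proof -
  interpret vector_space s by fact
  let ?f = "\<lambda>u. \<Sum>v\<in>B. s (u v) v"
  have inj: "inj_on ?f (B \<rightarrow>\<^sub>E UNIV)"
  proof (rule inj_onI)
    fix u w assume u: "u \<in> B \<rightarrow>\<^sub>E (UNIV::'a set)" and w: "w \<in> B \<rightarrow>\<^sub>E (UNIV::'a set)" and e: "?f u = ?f w"
    from e have "(\<Sum>v\<in>B. s (u v - w v) v) = 0"
      by (simp add: scale_left_diff_distrib sum_subtractf)
    from independentD[OF assms(3,2) order_refl this] have "u v = w v" if "v \<in> B" for v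
      using that by fastforce
    with u w show "u = w" by (intro PiE_ext) auto
  qed
  then show ?thesis
    using card_image[OF inj] card_funcsetE[OF assms(2), of "UNIV :: 'a set"]
    by (simp add: span_eq_image_PiE[OF assms(1,2)])
qed

text \<open>The ambient function types are infinite-dimensional, so dimensions of the concrete
  spaces are read off from their numbers of elements.\<close>

lemma card_basis:
  fixes s :: "'a::{field,finite} \<Rightarrow> 'b::ab_group_add \<Rightarrow> 'b"
  assumes "vector_space s" "finite B" "\<not> module.dependent s B"
    and "card (module.span s B) = CARD('a) ^ d"
  shows "card B = d"
proof -
  have "1 < CARD('a)"
    using card_mono[of "UNIV :: 'a set" "{0,1}"] by simp
  then show ?thesis
    using card_span_independent[OF assms(1-3)] assms(4) power_inject_exp by metis
qed

lemma span_eq_self: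
  assumes "vector_space s" "module.subspace s V" "B \<subseteq> V" "V \<subseteq> module.span s B"
  shows "module.span s B = V"
proof -
  interpret vector_space s by fact
  show ?thesis using assms(2-4) span_minimal by blast
qed

text \<open>Split a basis of \<open>X\<close> into \<open>B1\<close> with \<open>m\<close> and
  \<open>B2\<close> with \<open>N - m\<close> elements. The graph of a map from \<open>B1\<close> to
  \<open>span B2\<close>, spanned by the vectors \<open>b + \<phi> b\<close>, is an
  \<open>m\<close>-dimensional subspace that determines the map. The bound is the number of such
  maps.\<close>

lemma card_subspaces_ge:
  fixes s :: "'a::{field,finite} \<Rightarrow> 'b::ab_group_add \<Rightarrow> 'b"
  assumes vs: "vector_space s" and X: "module.subspace s X" "card X = CARD('a) ^ N"
    and m: "m \<le> N"
  shows "CARD('a) ^ ((N - m) * m)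
    \<le> card {U. module.subspace s U \<and> U \<subseteq> X \<and> vector_space.dim s U = m}"
proof -
  interpret vector_space s by fact
  have fX: "finite X" using X(2) by (intro card_ge_0_finite) simp
  obtain B where B: "B \<subseteq> X" "independent B" "X \<subseteq> span B" by (rule basis_exists)
  have fB: "finite B" using B(1) fX by (rule finite_subset)
  have sB: "span B = X" by (rule span_eq_self[OF vs X(1) B(1,3)])
  have cB: "card B = N" using card_basis[OF vs fB B(2)] sB X(2) by simp
  obtain B1 where B1: "B1 \<subseteq> B" "card B1 = m" "finite B1"
    using obtain_subset_with_card_n[of m B] m cB by metis
  define B2 where "B2 = B - B1"
  have B2: "B2 \<subseteq> B" "finite B2" "card B2 = N - m"
    using fB B1 cB by (auto simp: B2_def card_Diff_subset)
  have iB2: "independent B2" using independent_mono[OF B(2) B2(1)] .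
  have UX: "span B2 \<subseteq> X" using span_mono[OF B2(1)] sB by simp
  define g where "g \<phi> b = b + \<phi> b" for \<phi> :: "'b \<Rightarrow> 'b" and b
  have disj: "c b = 0" if e: "(\<Sum>b\<in>B1. s (c b) b) \<in> span B2" and b: "b \<in> B1" for c b
  proof -
    from e obtain d where d: "(\<Sum>b\<in>B1. s (c b) b) = (\<Sum>b\<in>B2. s (d b) b)"
      using span_finite[OF B2(2)] by auto
    let ?u = "\<lambda>b. if b \<in> B1 then c b else - d b"
    have "(\<Sum>b\<in>B. s (?u b) b) = (\<Sum>b\<in>B1. s (?u b) b) + (\<Sum>b\<in>B2. s (?u b) b)"
      using B1 B2 fB by (subst sum.union_disjoint[symmetric]) (auto simp: B2_def Un_absorb1)
    also have "(\<Sum>b\<in>B1. s (?u b) b) = (\<Sum>b\<in>B1. s (c b) b)" by (intro sum.cong) auto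
    also have "(\<Sum>b\<in>B2. s (?u b) b) = - (\<Sum>b\<in>B2. s (d b) b)"
      by (subst sum_negf[symmetric], intro sum.cong) (auto simp: B2_def)
    finally have "(\<Sum>b\<in>B. s (?u b) b) = 0" using d by simp
    from independentD[OF B(2) fB order_refl this] b B1 have "?u b = 0" by blast
    with b show ?thesis by simp
  qed
  have gsum: "(\<Sum>b\<in>B1. s (c b) (g \<phi> b)) = (\<Sum>b\<in>B1. s (c b) b) + (\<Sum>b\<in>B1. s (c b) (\<phi> b))"
    for c \<phi> by (simp add: g_def scale_right_distrib sum.distrib)
  have in2: "(\<Sum>b\<in>B1. s (c b) (\<phi> b)) \<in> span B2" if "\<phi> \<in> B1 \<rightarrow>\<^sub>E span B2" for c \<phi>
    using that by (intro span_sum span_scale) auto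
  \<comment> \<open>A graph meets \<open>span B2\<close> trivially: subtracting the
    \<open>\<phi>\<close>-part, which lies in \<open>span B2\<close>, reduces this to
    \<open>disj\<close>.\<close>
  have meet: "c b = 0" if "\<phi> \<in> B1 \<rightarrow>\<^sub>E span B2" "(\<Sum>b\<in>B1. s (c b) (g \<phi> b)) \<in> span B2" "b \<in> B1" for c \<phi> b
  proof (rule disj[OF _ that(3)])
    show "(\<Sum>b\<in>B1. s (c b) b) \<in> span B2"
      using span_diff[OF that(2) in2[OF that(1), of c]] by (simp add: gsum)
  qed
  have inj: "inj_on (g \<phi>) B1" if \<phi>: "\<phi> \<in> B1 \<rightarrow>\<^sub>E span B2" for \<phi>
  proof (rule inj_onI, rule ccontr)
    fix x y assume xy: "x \<in> B1" "y \<in> B1" "g \<phi> x = g \<phi> y" "x \<noteq> y"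
    \<comment> \<open>Two equal graph vectors would give a vanishing combination with coefficients 1
      and -1, against \<open>meet\<close>.\<close>
    let ?c = "\<lambda>b. if b = x then 1 else if b = y then - 1 else (0::'a)"
    have "(\<Sum>b\<in>B1. s (?c b) (g \<phi> b)) = (\<Sum>b\<in>{x,y}. s (?c b) (g \<phi> b))"
      using xy B1 by (intro sum.mono_neutral_right) auto
    also have "\<dots> = 0" using xy by simp
    finally have "(\<Sum>b\<in>B1. s (?c b) (g \<phi> b)) \<in> span B2" by (simp add: span_zero)
    from meet[OF \<phi> this xy(1)] show False by simp
  qed
  define U where "U \<phi> = span (g \<phi> ` B1)" for \<phi>
  have Ueq: "U \<phi> = range (\<lambda>u. \<Sum>v\<in>B1. s (u v) (g \<phi> v))" if \<phi>: "\<phi> \<in> B1 \<rightarrow>\<^sub>E span B2" for \<phi>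
  proof
    show "range (\<lambda>u. \<Sum>v\<in>B1. s (u v) (g \<phi> v)) \<subseteq> U \<phi>"
      unfolding U_def image_subset_iff
      by (intro ballI span_sum span_scale) (rule span_base, blast)
    show "U \<phi> \<subseteq> range (\<lambda>u. \<Sum>v\<in>B1. s (u v) (g \<phi> v))"
    proof
      fix y assume "y \<in> U \<phi>"
      then obtain u where "y = (\<Sum>v\<in>g \<phi> ` B1. s (u v) v)"
        using B1(3) by (auto simp: U_def span_finite)
      then have "y = (\<Sum>v\<in>B1. s (u (g \<phi> v)) (g \<phi> v))"
        using inj[OF \<phi>] by (simp add: sum.reindex)
      then show "y \<in> range (\<lambda>u. \<Sum>v\<in>B1. s (u v) (g \<phi> v))"
        by (intro range_eqI[where x = "\<lambda>v. u (g \<phi> v)"])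
    qed
  qed
  have ind: "independent (g \<phi> ` B1)" if \<phi>: "\<phi> \<in> B1 \<rightarrow>\<^sub>E span B2" for \<phi>
  proof (rule independent_if_scalars_zero)
    fix f x assume z: "(\<Sum>x\<in>g \<phi> ` B1. s (f x) x) = 0" and x: "x \<in> g \<phi> ` B1"
    then obtain b where b: "b \<in> B1" "x = g \<phi> b" by auto
    have "(\<Sum>b\<in>B1. s (f (g \<phi> b)) (g \<phi> b)) = 0" using z inj[OF \<phi>] by (simp add: sum.reindex)
    then have "(\<Sum>b\<in>B1. s (f (g \<phi> b)) (g \<phi> b)) \<in> span B2" by (simp add: span_zero)
    from meet[OF \<phi> this b(1)] b show "f x = 0" by simp
  qed (use B1 in auto)
  have memU: "U \<phi> \<in> {U. subspace U \<and> U \<subseteq> X \<and> dim U = m}" if \<phi>: "\<phi> \<in> B1 \<rightarrow>\<^sub>E span B2" for \<phi>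
  proof -
    have "g \<phi> ` B1 \<subseteq> X"
      using \<phi> UX B1(1) B(1) by (auto simp: g_def intro!: subspace_add[OF X(1)])
    then have "U \<phi> \<subseteq> X" unfolding U_def by (rule span_minimal[OF _ X(1)])
    moreover have "dim (U \<phi>) = m"
      unfolding U_def using dim_eq_card[OF _ ind[OF \<phi>]] card_image[OF inj[OF \<phi>]] B1(2) span_span by metis
    ultimately show ?thesis by (simp add: U_def)
  qed
  have injU: "inj_on U (B1 \<rightarrow>\<^sub>E span B2)"
  proof (rule inj_onI)
    fix \<phi> \<psi> assume \<phi>: "\<phi> \<in> B1 \<rightarrow>\<^sub>E span B2" and \<psi>: "\<psi> \<in> B1 \<rightarrow>\<^sub>E span B2" and e: "U \<phi> = U \<psi>"
    show "\<phi> = \<psi>"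
    proof (rule PiE_ext[OF \<phi> \<psi>])
      fix b assume b: "b \<in> B1"
      have "g \<phi> b \<in> U \<phi>" "g \<psi> b \<in> U \<psi>"
        using b by (auto simp: U_def intro: span_base)
      then have "g \<phi> b \<in> U \<phi>" "g \<psi> b \<in> U \<phi>" by (simp_all add: e)
      \<comment> \<open>Here \<open>b\<close> cancels, so \<open>\<phi> b - \<psi> b\<close> lies
        both in the graph and in \<open>span B2\<close>.\<close>
      then have "g \<phi> b - g \<psi> b \<in> U \<phi>" by (simp add: U_def span_diff)
      then obtain c where c: "\<phi> b - \<psi> b = (\<Sum>v\<in>B1. s (c v) (g \<phi> v))"
        unfolding Ueq[OF \<phi>] by (auto simp: g_def)
      have "\<phi> b - \<psi> b \<in> span B2" using \<phi> \<psi> b by (intro span_diff) auto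
      with c have "c v = 0" if "v \<in> B1" for v using meet[OF \<phi>, of c v] that by simp
      with c show "\<phi> b = \<psi> b" by simp
    qed
  qed
  have "card (B1 \<rightarrow>\<^sub>E span B2) = CARD('a) ^ ((N - m) * m)"
    using card_funcsetE[OF B1(3), of "span B2"] card_span_independent[OF vs B2(2) iB2] B1(2) B2(3)
    by (simp add: power_mult)
  moreover have "finite {U. subspace U \<and> U \<subseteq> X \<and> dim U = m}"
    by (rule finite_subset[of _ "Pow X"]) (use fX in auto)
  ultimately show ?thesis
    using card_inj_on_le[OF injU, of "{U. subspace U \<and> U \<subseteq> X \<and> dim U = m}"] memU by auto
qed

section \<open>Sizes of the concrete spaces and of the Grassmannian\<close>

lemma subspace_Fn: "VV.subspace (Fn n)"
  by (auto simp: VV.subspace_def Fn_def scaleV_def)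

lemma card_Fn: "card (Fn n :: (nat \<Rightarrow> 'a::{field,finite}) set) = CARD('a) ^ n"
proof -
  have "bij_betw (\<lambda>v. restrict v {..<n}) (Fn n) ({..<n} \<rightarrow>\<^sub>E (UNIV :: 'a set))"
    by (rule bij_betw_byWitness[where f' = "\<lambda>v i. if i < n then v i else 0"])
      (auto simp: Fn_def fun_eq_iff PiE_def extensional_def)
  from bij_betw_same_card[OF this] show ?thesis by (simp add: card_funcsetE)
qed

lemma finite_Fn: "finite (Fn n :: (nat \<Rightarrow> 'a::{field,finite}) set)"
  by (rule card_ge_0_finite) (simp add: card_Fn)

text \<open>The positions of the free entries of an alternating matrix; later also the index pairs
  at which an alternating form is evaluated on a basis.\<close>

definition pairs :: "nat \<Rightarrow> (nat \<times> nat) set"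
  where "pairs n = {(i, j). i < j \<and> j < n}"

lemma finite_pairs: "finite (pairs n)"
  by (rule finite_subset[of _ "{..<n} \<times> {..<n}"]) (auto simp: pairs_def)

lemma card_pairs: "card (pairs n) = n choose 2"
proof (induction n)
  case (Suc n)
  have "pairs (Suc n) = pairs n \<union> (\<lambda>i. (i, n)) ` {..<n}"
    by (auto simp: pairs_def)
  moreover have "pairs n \<inter> (\<lambda>i. (i, n)) ` {..<n} = {}" by (auto simp: pairs_def)
  ultimately have "card (pairs (Suc n)) = card (pairs n) + n"
    by (simp add: card_Un_disjoint finite_pairs card_image inj_on_def)
  then show ?case using Suc by (simp add: numeral_2_eq_2)
qed (simp add: pairs_def)

lemma card_ext2: "card (ext2 n :: (nat \<Rightarrow> nat \<Rightarrow> 'a::{field,finite}) set) = CARD('a) ^ (n choose 2)"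
proof -
  let ?r = "\<lambda>A. restrict (\<lambda>(i, j). A i j) (pairs n)"
  let ?e = "\<lambda>c i j. if (i, j) \<in> pairs n then c (i, j) else if (j, i) \<in> pairs n then - c (j, i) else (0::'a)"
  have "bij_betw ?r (alt n) (pairs n \<rightarrow>\<^sub>E (UNIV :: 'a set))"
  proof (rule bij_betw_byWitness[where f' = ?e])
    show "\<forall>A\<in>alt n. ?e (?r A) = A"
    proof (intro ballI ext)
      fix A :: "nat \<Rightarrow> nat \<Rightarrow> 'a" and i j assume A: "A \<in> alt n"
      then have d: "A i i = 0" and z: "n \<le> i \<or> n \<le> j \<Longrightarrow> A i j = 0" and sk: "A i j + A j i = 0"
        unfolding alt_def by blast+
      have sk': "A i j = - A j i" using sk by (rule eq_neg_iff_add_eq_0[THEN iffD2])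
      consider "i < j" | "i = j" | "j < i" by linarith
      then show "?e (?r A) i j = A i j"
      proof cases
        case 1 then show ?thesis using z by (simp add: pairs_def)
      next
        case 2 then show ?thesis using d by (simp add: pairs_def)
      next
        case 3 then show ?thesis using z sk' by (simp add: pairs_def)
      qed
    qed
    show "\<forall>c\<in>pairs n \<rightarrow>\<^sub>E UNIV. ?r (?e c) = c"
    proof
      fix c :: "nat \<times> nat \<Rightarrow> 'a" assume c: "c \<in> pairs n \<rightarrow>\<^sub>E UNIV"
      show "?r (?e c) = c"
      proof
        fix p show "?r (?e c) p = c p"
          using PiE_arb[OF c, of p] by (cases p) simp
      qed
    qed
    show "?e ` (pairs n \<rightarrow>\<^sub>E UNIV) \<subseteq> alt n"
    proof (rule image_subsetI)
      fix c :: "nat \<times> nat \<Rightarrow> 'a"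
      show "?e c \<in> alt n"
        unfolding alt_def mem_Collect_eq
      proof (intro conjI allI impI)
        fix i j show "?e c i j + ?e c j i = 0"
          by (cases i j rule: linorder_cases) (simp_all add: pairs_def)
      qed (auto simp: pairs_def)
    qed
  qed auto
  from bij_betw_same_card[OF this] show ?thesis
    by (simp add: ext2_eq card_funcsetE finite_pairs card_pairs)
qed

lemma card_Xsp: "card (Xsp n :: 'a::{field,finite} bivec set) = CARD('a) ^ ((n choose 2) + n)"
  by (simp add: Xsp_def card_cartesian_product card_ext2 card_Fn power_add)

lemma finite_Xsp: "finite (Xsp n :: 'a::{field,finite} bivec set)"
  by (rule card_ge_0_finite) (simp add: card_Xsp)

lemma card_XW: "card (XW n m :: (nat \<Rightarrow> 'a::{field,finite} bivec) set) = CARD('a) ^ (((n choose 2) + n) * m)"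
proof -
  have "bij_betw (\<lambda>v. restrict v {..<m}) (XW n m) ({..<m} \<rightarrow>\<^sub>E (Xsp n :: 'a bivec set))"
    by (rule bij_betw_byWitness[where f' = "\<lambda>v i. if i < m then v i else 0"])
      (auto simp: XW_def fun_eq_iff PiE_def extensional_def)
  from bij_betw_same_card[OF this] show ?thesis by (simp add: card_funcsetE card_Xsp power_mult)
qed

lemma finite_XW: "finite (XW n m :: (nat \<Rightarrow> 'a::{field,finite} bivec) set)"
  by (rule card_ge_0_finite) (simp add: card_XW)

lemma card_Gr_ge:
  assumes "m \<le> (n choose 2) + n"
  shows "CARD('a) ^ (((n choose 2) + n - m) * m) \<le> card (Gr n m :: 'a::{field,finite} bivec set set)"
  unfolding Gr_def by (rule card_subspaces_ge[OF vector_space_scaleX subspace_Xsp card_Xsp assms])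

section \<open>Operators far from and near to scalars\<close>

lemma carrier_GL:
  "carrier (GL ty n) = {P \<in> carrier_mat n n. \<exists>P'\<in>carrier_mat n n. P' * P = 1\<^sub>m n \<and> P * P' = 1\<^sub>m n}"
  by (auto simp: GL_def units_of_def Units_def ring_mat_def)

lemma transpose_GL:
  assumes "P \<in> carrier (GL ty n)"
  shows "transpose_mat P \<in> carrier (GL ty n)"
proof -
  from assms obtain P' where P: "P \<in> carrier_mat n n" "P' \<in> carrier_mat n n" "P' * P = 1\<^sub>m n" "P * P' = 1\<^sub>m n"
    by (auto simp: carrier_GL)
  then have "transpose_mat P * transpose_mat P' = 1\<^sub>m n" "transpose_mat P' * transpose_mat P = 1\<^sub>m n"
    by (simp_all flip: transpose_mult)
  with P show ?thesis by (auto simp: carrier_GL intro!: bexI[of _ "transpose_mat P'"])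
qed

lemma card_carrier_mat: "card (carrier_mat n n :: 'a::{field,finite} mat set) = CARD('a) ^ (n ^ 2)"
proof -
  have "bij_betw (\<lambda>M. restrict (\<lambda>p. M $$ p) ({..<n} \<times> {..<n})) (carrier_mat n n)
      ({..<n} \<times> {..<n} \<rightarrow>\<^sub>E (UNIV :: 'a set))"
    by (rule bij_betw_byWitness[where f' = "mat n n"])
      (auto simp: fun_eq_iff PiE_def extensional_def intro!: eq_matI)
  from bij_betw_same_card[OF this] show ?thesis by (simp add: card_funcsetE power2_eq_square)
qed

lemma finite_carrier_mat: "finite (carrier_mat n n :: 'a::{field,finite} mat set)"
  by (rule card_ge_0_finite) (simp add: card_carrier_mat)

lemma finite_carrier_GL: "finite (carrier (GL (ty :: 'a::{field,finite} itself) n))"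
  by (rule finite_subset[OF _ finite_carrier_mat]) (auto simp: carrier_GL)

lemma order_GL_le: "order (GL (ty :: 'a::{field,finite} itself) n) \<le> CARD('a) ^ (n ^ 2)"
  unfolding order_def card_carrier_mat[symmetric]
  by (rule card_mono[OF finite_carrier_mat]) (auto simp: carrier_GL)

lemma order_GL_pos: "0 < order (GL (ty :: 'a::{field,finite} itself) n)"
proof -
  interpret group "GL ty n" by (rule group_GL)
  show ?thesis unfolding order_def using finite_carrier_GL[of ty n] one_closed card_gt_0_iff by blast
qed

lemma inj_on_actV:
  assumes "P \<in> carrier (GL ty n)" shows "inj_on (actV n P) (Fn n)"
proof -
  from assms obtain P' where P: "P \<in> carrier_mat n n" "P' \<in> carrier_mat n n" "P' * P = 1\<^sub>m n"
    by (auto simp: carrier_GL)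
  show ?thesis
    by (rule inj_on_inverseI[of _ "actV n P'"])
      (simp add: P(3) actV_one flip: actV_mult[OF P(2,1)])
qed

lemma actV_image:
  assumes "P \<in> carrier (GL ty n)" shows "actV n P ` Fn n = Fn n"
proof -
  from assms obtain P' where P: "P \<in> carrier_mat n n" "P' \<in> carrier_mat n n" "P * P' = 1\<^sub>m n"
    by (auto simp: carrier_GL)
  have "x = actV n P (actV n P' x)" if "x \<in> Fn n" for x
    using that by (simp add: P(3) actV_one flip: actV_mult[OF P(1,2)])
  then show ?thesis using actV_Fn by blast
qed

lemma inj_on_actX:
  assumes "P \<in> carrier (GL ty n)" shows "inj_on (actX n P) (Xsp n)"
proof -
  from assms obtain P' where P: "P \<in> carrier_mat n n" "P' \<in> carrier_mat n n" "P' * P = 1\<^sub>m n"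
    by (auto simp: carrier_GL)
  show ?thesis
    by (rule inj_on_inverseI[of _ "actX n P'"])
      (simp add: P(3) actX_one flip: actX_mult[OF P(2,1)])
qed

text \<open>The size of such a family measures how far \<open>S\<close> is from a scalar.
  Independence of the union as a set does not see coincidences; injectivity and disjointness ensure
  that the union has \<open>2 * card F\<close> elements.\<close>

definition spread :: "nat \<Rightarrow> ((nat \<Rightarrow> 'a::field) \<Rightarrow> nat \<Rightarrow> 'a) \<Rightarrow> (nat \<Rightarrow> 'a) set \<Rightarrow> bool"
  where "spread n S F \<longleftrightarrow> F \<subseteq> Fn n \<and> inj_on S F \<and> F \<inter> S ` F = {} \<and> VV.independent (F \<union> S ` F)"

lemma spread_mono: "spread n S F \<Longrightarrow> F' \<subseteq> F \<Longrightarrow> spread n S F'"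
proof -
  assume F: "spread n S F" and sub: "F' \<subseteq> F"
  then have "F' \<union> S ` F' \<subseteq> F \<union> S ` F" by blast
  with F have "VV.independent (F' \<union> S ` F')" using VV.independent_mono unfolding spread_def by blast
  moreover have "inj_on S F'" using F sub by (auto simp: spread_def intro: inj_on_subset)
  moreover have "F' \<inter> S ` F' = {}" "F' \<subseteq> Fn n" using F sub unfolding spread_def by blast+
  ultimately show ?thesis by (simp add: spread_def)
qed

lemma spread_finite: "spread n S F \<Longrightarrow> finite (F :: (nat \<Rightarrow> 'a::{field,finite}) set)"
  by (rule finite_subset[OF _ finite_Fn[of n]]) (simp add: spread_def)

text \<open>If no such \<open>a\<close> existed, \<open>x\<close> and \<open>S x\<close> would be
  independent modulo the span of \<open>F\<close> and its image, and \<open>insert x F\<close> would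
  be a larger spread family.\<close>

lemma spread_maximal:
  fixes S :: "(nat \<Rightarrow> 'a::{field,finite}) \<Rightarrow> nat \<Rightarrow> 'a"
  assumes F: "spread n S F" and max: "\<And>F'. spread n S F' \<Longrightarrow> card F' \<le> card F"
    and x: "x \<in> Fn n" "x \<notin> VV.span (F \<union> S ` F)"
  shows "\<exists>a. S x - scaleV a x \<in> VV.span (F \<union> S ` F)"
proof (rule ccontr)
  let ?G = "F \<union> S ` F"
  assume "\<not> ?thesis"
  then have Sx: "S x \<notin> VV.span (insert x ?G)" by (simp add: VV.span_breakdown_eq)
  have xG: "x \<notin> ?G" using x(2) by (rule contrapos_nn) (rule VV.span_base)
  have SxG: "S x \<notin> insert x ?G" using Sx by (rule contrapos_nn) (rule VV.span_base)
  have "VV.independent (insert (S x) (insert x ?G))"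
    using F x(2) Sx xG SxG by (intro VV.independent_insertI) (auto simp: spread_def)
  moreover have "insert x F \<union> S ` insert x F = insert (S x) (insert x ?G)" by auto
  ultimately have "spread n S (insert x F)"
    unfolding spread_def using F x(1) xG SxG by (auto simp: spread_def)
  from max[OF this] xG spread_finite[OF F] show False by simp
qed

text \<open>If all vectors outside a subspace are eigenvectors modulo it, the eigenvalue is the same
  for all of them. As \<open>span G\<close> is not assumed to be invariant under \<open>S\<close>,
  the statement about all of \<open>Fn n\<close> is made modulo \<open>G\<close> and
  \<open>y\<close>.\<close>

lemma eigen_mod:
  assumes lin: "Vector_Spaces.linear scaleV scaleV S"
    and eig: "\<And>x. x \<in> Fn n \<Longrightarrow> x \<notin> VV.span G \<Longrightarrow> \<exists>a. S x - scaleV a x \<in> VV.span G"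
    and y: "y \<in> Fn n" "y \<notin> VV.span G"
  obtains a where "S y - scaleV a y \<in> VV.span G"
    and "\<And>x. x \<in> Fn n \<Longrightarrow> x \<notin> VV.span (insert y G) \<Longrightarrow> S x - scaleV a x \<in> VV.span G"
    and "\<And>x. x \<in> Fn n \<Longrightarrow> S x - scaleV a x \<in> VV.span (insert y G)"
proof -
  interpret L: Vector_Spaces.linear scaleV scaleV S by fact
  from eig[OF y] obtain a where a: "S y - scaleV a y \<in> VV.span G" by blast
  have sub: "VV.span G \<subseteq> VV.span (insert y G)" by (rule VV.span_mono) auto
  have yG: "y \<in> VV.span (insert y G)" by (rule VV.span_base) simp
  have Sy: "S y \<in> VV.span (insert y G)"
    using VV.span_add[OF subsetD[OF sub a] VV.span_scale[OF yG, of a]] by simp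
  \<comment> \<open>With eigenvalues \<open>b\<close>, \<open>a\<close>, \<open>c\<close> of
    \<open>x\<close>, \<open>y\<close>, \<open>x + y\<close>, linearity puts a combination of
    \<open>x\<close> and \<open>y\<close> into \<open>span G\<close>. Their independence modulo
    \<open>G\<close> gives \<open>b = c\<close> and then \<open>a = c\<close>.\<close>
  have out: "S x - scaleV a x \<in> VV.span G" if x: "x \<in> Fn n" "x \<notin> VV.span (insert y G)" for x
  proof -
    have "x \<notin> VV.span G" using x(2) sub by blast
    then obtain b where b: "S x - scaleV b x \<in> VV.span G" using eig x(1) by blast
    have "x + y \<notin> VV.span G"
      using x(2) sub VV.span_diff[OF _ yG, of "x + y"] by auto
    moreover have "x + y \<in> Fn n" using x(1) y(1) VV.subspace_add[OF subspace_Fn] by blast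
    ultimately obtain c where c: "S (x + y) - scaleV c (x + y) \<in> VV.span G" using eig by blast
    have "S (x + y) - scaleV c (x + y) - (S x - scaleV b x) - (S y - scaleV a y) \<in> VV.span G"
      by (intro VV.span_diff a b c)
    then have d: "scaleV (b - c) x + scaleV (a - c) y \<in> VV.span G"
      by (simp add: L.add VV.scale_left_diff_distrib VV.scale_right_distrib algebra_simps)
    have bc: "b = c"
    proof (rule ccontr)
      assume "b \<noteq> c"
      have "scaleV (b - c) x \<in> VV.span (insert y G)"
        using VV.span_diff[OF subsetD[OF sub d] VV.span_scale[OF yG, of "a - c"]] by simp
      from VV.span_scale[OF this, of "inverse (b - c)"] \<open>b \<noteq> c\<close> x(2) show False by simp
    qed
    with d have "scaleV (a - c) y \<in> VV.span G" by simp
    have "a = c"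
    proof (rule ccontr)
      assume "a \<noteq> c"
      with VV.span_scale[OF \<open>scaleV (a - c) y \<in> VV.span G\<close>, of "inverse (a - c)"] y(2) show False
        by simp
    qed
    with b bc show ?thesis by simp
  qed
  \<comment> \<open>The vector \<open>x + y\<close> lies outside \<open>span G\<close>, so its
    eigenvector relation expresses \<open>S x\<close> through \<open>S y\<close>, \<open>x\<close>,
    \<open>y\<close> and \<open>G\<close>.\<close>
  have inG: "S x \<in> VV.span (insert y G)" if x: "x \<in> Fn n" "x \<in> VV.span G" for x
  proof -
    have "x + y \<notin> VV.span G" using y(2) VV.span_diff[OF _ x(2), of "x + y"] by auto
    moreover have "x + y \<in> Fn n" using x(1) y(1) VV.subspace_add[OF subspace_Fn] by blast
    ultimately obtain c where c: "S (x + y) - scaleV c (x + y) \<in> VV.span G" using eig by blast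
    have "scaleV c (x + y) \<in> VV.span (insert y G)"
      by (intro VV.span_scale VV.span_add subsetD[OF sub x(2)] yG)
    from VV.span_diff[OF VV.span_add[OF subsetD[OF sub c] this] Sy]
    have "S (x + y) - S y \<in> VV.span (insert y G)" by simp
    then show ?thesis by (simp add: L.add)
  qed
  have "S x - scaleV a x \<in> VV.span (insert y G)" if x: "x \<in> Fn n" for x
  proof (cases "x \<in> VV.span (insert y G)")
    case True
    then obtain k where k: "x - scaleV k y \<in> VV.span G" unfolding VV.span_breakdown_eq by blast
    have "x - scaleV k y \<in> Fn n"
      using x y(1) VV.subspace_diff[OF subspace_Fn] VV.subspace_scale[OF subspace_Fn] by blast
    from VV.span_diff[OF VV.span_add[OF inG[OF this k] VV.span_scale[OF Sy, of k]] VV.span_scale[OF True, of a]]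
    have "S (x - scaleV k y) + scaleV k (S y) - scaleV a x \<in> VV.span (insert y G)" .
    then show ?thesis by (simp add: L.diff L.scale)
  qed (use out x sub in blast)
  with a out show thesis by (rule that)
qed

text \<open>Take a spread family \<open>F\<close> of maximal size. If it has fewer than
  \<open>K\<close> elements, then \<open>F\<close>, its image and at most one further vector are at
  most \<open>2 * (K - 1) + 1\<close> vectors modulo which \<open>S\<close> is scalar.\<close>

lemma spread_or_near_scalar:
  fixes S :: "(nat \<Rightarrow> 'a::{field,finite}) \<Rightarrow> nat \<Rightarrow> 'a"
  assumes lin: "Vector_Spaces.linear scaleV scaleV S" and S: "S ` Fn n \<subseteq> Fn n" and K: "0 < K"
  obtains F where "spread n S F" "card F = K"
  | a G where "G \<subseteq> Fn n" "card G \<le> 2 * K" "\<And>x. x \<in> Fn n \<Longrightarrow> S x - scaleV a x \<in> VV.span G"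
proof -
  have s0: "spread n S {}" by (simp add: spread_def VV.independent_empty)
  have fin: "finite {F. spread n S F}"
    by (rule finite_subset[of _ "Pow (Fn n)"]) (auto simp: spread_def finite_Fn)
  define N where "N = Max (card ` {F. spread n S F})"
  have fin': "finite (card ` {F. spread n S F})" using fin by (rule finite_imageI)
  have "N \<in> card ` {F. spread n S F}" unfolding N_def using s0 by (intro Max_in[OF fin']) blast
  then obtain F where F: "spread n S F" and N: "N = card F" by blast
  have max: "card F' \<le> card F" if "spread n S F'" for F'
    using Max_ge[OF fin', of "card F'"] that by (simp flip: N_def N)
  let ?G = "F \<union> S ` F"
  have "F \<subseteq> Fn n" using F by (simp add: spread_def)
  then have GF: "?G \<subseteq> Fn n" using S by blast
  have cG: "card ?G \<le> 2 * card F"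
    using card_Un_le[of F "S ` F"] card_image_le[OF spread_finite[OF F], of S] by simp
  show thesis
  proof (cases "K \<le> card F")
    case True
    then obtain F' where "F' \<subseteq> F" "card F' = K" by (metis obtain_subset_with_card_n)
    with spread_mono[OF F] that(1) show thesis by blast
  next
    case less: False
    show thesis
    proof (cases "Fn n \<subseteq> VV.span ?G")
      case True
      \<comment> \<open>Modulo the whole space any scalar works; 0 is chosen.\<close>
      show thesis
      proof (rule that(2)[OF GF])
        show "S x - scaleV 0 x \<in> VV.span ?G" if "x \<in> Fn n" for x
        proof -
          have "S x \<in> VV.span ?G" using that True S by blast
          then show ?thesis by simp
        qed
      qed (use cG less in simp)
    next
      case False
      then obtain y where y: "y \<in> Fn n" "y \<notin> VV.span ?G" by blast
      obtain a where "\<And>x. x \<in> Fn n \<Longrightarrow> S x - scaleV a x \<in> VV.span (insert y ?G)"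
        using eigen_mod[OF lin spread_maximal[OF F max] y] by blast
      moreover have "card (insert y ?G) \<le> 2 * K"
        using card_insert_le_m1[of "2 * K" ?G y] cG less by simp
      ultimately show thesis using that(2)[of "insert y ?G"] y(1) GF by blast
    qed
  qed
qed

text \<open>\<open>spread_or_near_scalar\<close> with \<open>K = 1\<close> would leave an error of
  rank up to 2. Here the empty family is maximal, so \<open>eigen_mod\<close> applies with empty
  \<open>G\<close>, where congruences are equalities; multiples of \<open>y\<close> follow by
  linearity.\<close>

lemma spread_or_scalar:
  fixes S :: "(nat \<Rightarrow> 'a::{field,finite}) \<Rightarrow> nat \<Rightarrow> 'a"
  assumes lin: "Vector_Spaces.linear scaleV scaleV S" and S: "S ` Fn n \<subseteq> Fn n"
  obtains x where "spread n S {x}"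
  | a where "\<And>x. x \<in> Fn n \<Longrightarrow> S x = scaleV a x"
proof (cases "\<exists>x. spread n S {x}")
  case False
  interpret L: Vector_Spaces.linear scaleV scaleV S by fact
  have s0: "spread n S {}" by (simp add: spread_def VV.independent_empty)
  have "card F' \<le> card ({} :: (nat \<Rightarrow> 'a) set)" if F': "spread n S F'" for F'
  proof (cases "F' = {}")
    case False
    then obtain x where "x \<in> F'" by blast
    then have "spread n S {x}" using spread_mono[OF F', of "{x}"] by simp
    with \<open>\<nexists>x. spread n S {x}\<close> show ?thesis by blast
  qed simp
  from spread_maximal[OF s0 this]
  have eig: "\<And>x. x \<in> Fn n \<Longrightarrow> x \<notin> VV.span {} \<Longrightarrow> \<exists>a. S x - scaleV a x \<in> VV.span {}" by simp
  show thesis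
  proof (cases "Fn n \<subseteq> VV.span ({} :: (nat \<Rightarrow> 'a) set)")
    case True
    have "S x = scaleV 0 x" if "x \<in> Fn n" for x
      using that True by (auto simp: L.zero)
    then show thesis by (rule that(2))
  next
    case False
    then obtain y :: "nat \<Rightarrow> 'a" where y: "y \<in> Fn n" "y \<notin> VV.span {}" by blast
    obtain a where a: "S y - scaleV a y \<in> VV.span {}"
      "\<And>x. x \<in> Fn n \<Longrightarrow> x \<notin> VV.span {y} \<Longrightarrow> S x - scaleV a x \<in> VV.span {}"
      using eigen_mod[OF lin eig y] by metis
    show thesis
    proof (rule that(2))
      fix x :: "nat \<Rightarrow> 'a" assume x: "x \<in> Fn n"
      show "S x = scaleV a x"
      proof (cases "x \<in> VV.span {y}")
        case True
        then obtain k where "x = scaleV k y" by (auto simp: VV.span_singleton)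
        with a(1) show ?thesis by (simp add: L.scale mult.commute)
      qed (use a(2) x in auto)
    qed
  qed
qed (use that in blast)

text \<open>Over a finite field these are the sums of a scalar and a map of rank at most
  \<open>K\<close>: \<open>Fn n\<close> is then finite, so \<open>card G \<le> K\<close> is a
  genuine bound.\<close>

definition near_scalar :: "nat \<Rightarrow> nat \<Rightarrow> 'a::field mat set"
  where "near_scalar n K = {M \<in> carrier_mat n n. \<exists>a G. G \<subseteq> Fn n \<and> card G \<le> K \<and>
    (\<forall>x\<in>Fn n. actV n M x - scaleV a x \<in> VV.span G)}"

text \<open>\<open>M\<close> is recovered from the scalar, from \<open>K\<close> vectors with
  \<open>n\<close> coordinates each, and from \<open>n * K\<close> coefficients that express the
  columns of the error.\<close>

lemma card_near_scalar:
  "card (near_scalar n K :: 'a::{field,finite} mat set) \<le> CARD('a) ^ (1 + 2 * K * n)"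
proof -
  let ?D = "(UNIV :: 'a set) \<times> ({..<K} \<rightarrow>\<^sub>E (Fn n :: (nat \<Rightarrow> 'a) set)) \<times> ({..<n} \<times> {..<K} \<rightarrow>\<^sub>E (UNIV :: 'a set))"
  let ?\<Phi> = "\<lambda>(a, z, c). mat n n (\<lambda>(i, j). (if i = j then a else 0) + (\<Sum>l<K. c (j, l) * z l i))"
  have "near_scalar n K \<subseteq> ?\<Phi> ` ?D"
  proof
    fix M :: "'a mat" assume "M \<in> near_scalar n K"
    then obtain a G where M: "M \<in> carrier_mat n n" and G: "G \<subseteq> Fn n" "card G \<le> K"
      and sp: "\<And>x. x \<in> Fn n \<Longrightarrow> actV n M x - scaleV a x \<in> VV.span G"
      unfolding near_scalar_def by blast
    have fG: "finite G" using G(1) finite_Fn finite_subset by blast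
    obtain h where h: "bij_betw h {..<card G} G"
      using ex_bij_betw_nat_finite[OF fG] by (auto simp: lessThan_atLeast0)
    have "\<forall>j. \<exists>u. j < n \<longrightarrow> actV n M (unitv j) - scaleV a (unitv j) = (\<Sum>v\<in>G. scaleV (u v) v)"
      using sp[OF unitv_Fn] unfolding VV.span_finite[OF fG] by blast
    then obtain u where u: "\<And>j. j < n \<Longrightarrow>
        actV n M (unitv j) - scaleV a (unitv j) = (\<Sum>v\<in>G. scaleV (u j v) v)"
      by metis
    \<comment> \<open>The list of generators is padded with zero vectors to length \<open>K\<close>,
      so that one parameter space serves every \<open>G\<close>.\<close>
    define z where "z = restrict (\<lambda>l. if l < card G then h l else 0) {..<K}"
    define c where "c = restrict (\<lambda>(j, l). u j (h l)) ({..<n} \<times> {..<K})"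
    have hF: "h l \<in> Fn n" if "l < card G" for l using h that G(1) by (auto simp: bij_betw_def)
    have "z \<in> {..<K} \<rightarrow>\<^sub>E Fn n"
      by (auto simp: z_def hF VV.subspace_0[OF subspace_Fn])
    then have D: "(a, z, c) \<in> ?D" by (auto simp: c_def)
    have "M = ?\<Phi> (a, z, c)"
    proof (rule eq_matI)
      fix i j assume "i < dim_row (?\<Phi> (a, z, c))" "j < dim_col (?\<Phi> (a, z, c))"
      then have i: "i < n" and j: "j < n" by auto
      have "(\<Sum>k<n. M $$ (i, k) * (if k = j then 1 else 0)) = (\<Sum>k<n. if k = j then M $$ (i, k) else 0)"
        by (intro sum.cong) auto
      then have 1: "actV n M (unitv j) i = M $$ (i, j)"
        using i j by (simp add: actV_def unitv_def)
      have "(\<Sum>v\<in>G. scaleV (u j v) v) i = (\<Sum>v\<in>G. u j v * v i)"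
        by (simp add: sum_fun_apply scaleV_def)
      also have "\<dots> = (\<Sum>l<card G. u j (h l) * h l i)"
        using sum.reindex_bij_betw[OF h, of "\<lambda>v. u j v * v i"] by simp
      also have "\<dots> = (\<Sum>l<K. if l < card G then u j (h l) * h l i else 0)"
        using G(2) by (intro sum.mono_neutral_cong_left) auto
      also have "\<dots> = (\<Sum>l<K. c (j, l) * z l i)"
        by (intro sum.cong) (auto simp: c_def z_def j)
      finally have "actV n M (unitv j) i - scaleV a (unitv j) i = (\<Sum>l<K. c (j, l) * z l i)"
        using u[OF j] by (simp add: fun_eq_iff)
      with 1 show "M $$ (i, j) = ?\<Phi> (a, z, c) $$ (i, j)"
        using i j by (auto simp: scaleV_def unitv_def algebra_simps)
    qed (use M in auto)
    with D show "M \<in> ?\<Phi> ` ?D" by (rule rev_image_eqI)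
  qed
  moreover have "finite ?D" by (intro finite_cartesian_product finite_PiE) (auto simp: finite_Fn)
  ultimately have "card (near_scalar n K :: 'a mat set) \<le> card ?D" by (rule surj_card_le[rotated])
  also have "\<dots> = CARD('a) ^ (1 + 2 * K * n)"
  proof -
    have "card ?D = CARD('a) * ((CARD('a) ^ n) ^ K * CARD('a) ^ (n * K))"
      by (simp add: card_cartesian_product card_funcsetE card_Fn)
    also have "\<dots> = CARD('a) ^ (1 + (n * K + n * K))"
      by (simp only: power_add power_mult power_one_right)
    also have "1 + (n * K + n * K) = 1 + 2 * K * n" by simp
    finally show ?thesis .
  qed
  finally show ?thesis .
qed

lemma finite_near_scalar: "finite (near_scalar n K :: 'a::{field,finite} mat set)"
  by (rule finite_subset[OF _ finite_carrier_mat]) (auto simp: near_scalar_def)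

lemma spread_or_mem_near_scalar:
  fixes M :: "'a::{field,finite} mat"
  assumes "M \<in> carrier_mat n n" "M \<notin> near_scalar n (2 * K)" "0 < K"
  obtains F where "spread n (actV n M) F" "card F = K"
proof (rule spread_or_near_scalar[OF linear_actV _ assms(3)])
  show "actV n M ` Fn n \<subseteq> Fn n" by (auto simp: actV_Fn)
qed (use assms(1,2) that in \<open>unfold near_scalar_def, blast+\<close>)

section \<open>Fixed tensors\<close>

lemma spread_extends_to_basis:
  fixes S :: "(nat \<Rightarrow> 'a::{field,finite}) \<Rightarrow> nat \<Rightarrow> 'a"
  assumes F: "spread n S F" and S: "S ` Fn n \<subseteq> Fn n"
  obtains B where "F \<union> S ` F \<subseteq> B" "B \<subseteq> Fn n" "finite B" "VV.span B = Fn n" "card B = n"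
proof -
  have "F \<subseteq> Fn n" and ind: "VV.independent (F \<union> S ` F)" using F by (simp_all add: spread_def)
  then have "F \<union> S ` F \<subseteq> Fn n" using S by blast
  from VV.maximal_independent_subset_extend[OF this ind] obtain B where
    B: "F \<union> S ` F \<subseteq> B" "B \<subseteq> Fn n" "VV.independent B" "Fn n \<subseteq> VV.span B" by blast
  have fB: "finite B" using B(2) finite_Fn by (rule finite_subset)
  have sB: "VV.span B = Fn n" by (rule span_eq_self[OF vector_space_scaleV subspace_Fn B(2,4)])
  have "card B = n"
    by (rule card_basis[OF vector_space_scaleV fB B(3)]) (simp add: sB card_Fn)
  with B fB sB that show thesis by blast
qed

lemma card_spread:
  fixes S :: "(nat \<Rightarrow> 'a::{field,finite}) \<Rightarrow> nat \<Rightarrow> 'a"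
  assumes F: "spread n S F"
  shows "card (S ` F) = card F" "card (F \<union> S ` F) = 2 * card F"
proof -
  show c: "card (S ` F) = card F" using F by (intro card_image) (simp add: spread_def)
  show "card (F \<union> S ` F) = 2 * card F"
    using F spread_finite[OF F] c by (subst card_Un_disjoint) (simp_all add: spread_def)
qed

section \<open>Fixed tensors as equivariant maps from the dual of W\<close>

definition fixXW :: "nat \<Rightarrow> nat \<Rightarrow> 'a::field mat \<Rightarrow> 'a mat \<Rightarrow> (nat \<Rightarrow> 'a bivec) set"
  where "fixXW n m P Q = {t \<in> XW n m. actXW n m (P, Q) t = t}"

lemma fixXW_D:
  assumes "t \<in> fixXW n m P Q" "k < m"
  shows "t k = (\<Sum>l<m. scaleX (Q $$ (k, l)) (actX n P (t l)))"
proof -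
  have "t k = actXW n m (P, Q) t k" using assms(1) by (simp add: fixXW_def)
  then show ?thesis using assms(2) by (simp add: actXW_def)
qed

text \<open>Contraction with a functional \<open>w\<close> on \<open>W\<close>, which turns
  \<open>t\<close> into a linear map from the dual of \<open>W\<close> to
  \<open>Xsp n\<close>.\<close>

definition comb :: "nat \<Rightarrow> (nat \<Rightarrow> 'a::field bivec) \<Rightarrow> (nat \<Rightarrow> 'a) \<Rightarrow> 'a bivec"
  where "comb m t w = (\<Sum>k<m. scaleX (w k) (t k))"

lemma comb_Xsp: "t \<in> XW n m \<Longrightarrow> comb m t w \<in> Xsp n"
  unfolding comb_def
  by (intro VX.subspace_sum[OF subspace_Xsp] VX.subspace_scale[OF subspace_Xsp]) (simp add: XW_def)

lemma comb_unitv: "k < m \<Longrightarrow> comb m t (unitv k) = t k"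
proof -
  assume k: "k < m"
  have "comb m t (unitv k) = (\<Sum>l<m. if l = k then t l else 0)"
    unfolding comb_def by (intro sum.cong) (auto simp: unitv_def)
  then show ?thesis using k by simp
qed

text \<open>A fixed \<open>t\<close> is an equivariant map; \<open>Q\<close> acts on the dual
  through its transpose.\<close>

lemma comb_fixXW:
  assumes t: "t \<in> fixXW n m P Q" and Q: "Q \<in> carrier_mat m m"
  shows "comb m t w = actX n P (comb m t (actV m (transpose_mat Q) w))"
proof -
  interpret L: Vector_Spaces.linear scaleX scaleX "actX n P" by (rule linear_actX)
  have "comb m t w = (\<Sum>k<m. scaleX (w k) (\<Sum>l<m. scaleX (Q $$ (k, l)) (actX n P (t l))))"
    unfolding comb_def by (intro sum.cong refl arg_cong[where f = "scaleX _"] fixXW_D[OF t]) simp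
  also have "\<dots> = (\<Sum>l<m. \<Sum>k<m. scaleX (w k * Q $$ (k, l)) (actX n P (t l)))"
    by (subst sum.swap) (simp add: VX.scale_sum_right)
  also have "\<dots> = (\<Sum>l<m. scaleX (actV m (transpose_mat Q) w l) (actX n P (t l)))"
    using Q by (intro sum.cong refl) (simp add: actV_def VX.scale_sum_left mult.commute)
  also have "\<dots> = actX n P (comb m t (actV m (transpose_mat Q) w))"
    by (simp add: comb_def L.sum L.scale)
  finally show ?thesis .
qed

text \<open>By \<open>comb_fixXW\<close> and injectivity of \<open>P\<close>, the values of
  \<open>t\<close> on \<open>F\<close> determine those on the image of \<open>F\<close>. So a fixed
  \<open>t\<close> is known from its values in \<open>Xsp n\<close> on the other
  \<open>m - card F\<close> basis vectors.\<close>

lemma card_fixXW_spread_right: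
  fixes P Q :: "'a::{field,finite} mat"
  assumes P: "P \<in> carrier (GL ty n)" and Q: "Q \<in> carrier_mat m m"
    and F: "spread m (actV m (transpose_mat Q)) F"
  shows "card (fixXW n m P Q) \<le> CARD('a) ^ (((n choose 2) + n) * (m - card F))"
proof -
  let ?S = "actV m (transpose_mat Q)"
  have "?S ` Fn m \<subseteq> Fn m" by (auto simp: actV_Fn)
  from spread_extends_to_basis[OF F this] obtain B where
    B: "F \<union> ?S ` F \<subseteq> B" "finite B" "VV.span B = Fn m" "card B = m" by metis
  let ?J = "B - ?S ` F"
  let ?r = "\<lambda>t. restrict (comb m t) ?J"
  have FJ: "F \<subseteq> ?J" using F B(1) by (auto simp: spread_def)
  have inj: "inj_on ?r (fixXW n m P Q)"
  proof (rule inj_onI)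
    fix t t' assume t: "t \<in> fixXW n m P Q" and t': "t' \<in> fixXW n m P Q" and e: "?r t = ?r t'"
    have X: "t \<in> XW n m" "t' \<in> XW n m" using t t' by (simp_all add: fixXW_def)
    have J: "comb m t w = comb m t' w" if "w \<in> ?J" for w
      using fun_cong[OF e, of w] that by simp
    have SF: "comb m t (?S w) = comb m t' (?S w)" if "w \<in> F" for w
    proof (rule inj_onD[OF inj_on_actX[OF P]])
      show "actX n P (comb m t (?S w)) = actX n P (comb m t' (?S w))"
        using J[of w] that FJ by (simp flip: comb_fixXW[OF t Q] comb_fixXW[OF t' Q]) blast
    qed (simp_all add: comb_Xsp X)
    have "VV.subspace {w. comb m t w = comb m t' w}"
      by (auto simp: VV.subspace_def comb_def scaleV_def VX.scale_left_distrib sum.distrib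
          simp flip: VX.scale_scale VX.scale_sum_right)
    moreover have "B \<subseteq> {w. comb m t w = comb m t' w}" using J SF by blast
    ultimately have all: "Fn m \<subseteq> {w. comb m t w = comb m t' w}"
      using VV.span_minimal B(3) by metis
    show "t = t'"
    proof
      fix k show "t k = t' k"
      proof (cases "k < m")
        case True
        then have "comb m t (unitv k) = comb m t' (unitv k)" using all unitv_Fn by blast
        then show ?thesis using True by (simp add: comb_unitv)
      qed (use X in \<open>simp add: XW_def\<close>)
    qed
  qed
  have "finite (?J \<rightarrow>\<^sub>E (Xsp n :: 'a bivec set))" using B(2) finite_Xsp by (intro finite_PiE) auto
  moreover have "?r ` fixXW n m P Q \<subseteq> ?J \<rightarrow>\<^sub>E Xsp n"
    by (intro image_subsetI) (simp add: restrict_PiE_iff fixXW_def comb_Xsp)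
  ultimately have "card (fixXW n m P Q) \<le> card (?J \<rightarrow>\<^sub>E (Xsp n :: 'a bivec set))"
    using inj by (intro card_inj_on_le)
  also have "\<dots> = card (Xsp n :: 'a bivec set) ^ (m - card F)"
    using B finite_subset[of "?S ` F" B] card_spread(1)[OF F] by (simp add: card_funcsetE card_Diff_subset)
  finally show ?thesis by (simp add: card_Xsp power_mult)
qed

section \<open>Fixed tensors as alternating forms on the dual of V\<close>

text \<open>
  The exterior square component of \<open>t\<close> is read as an alternating bilinear form on \<open>F\<^sup>n\<close> with values
  in \<open>F\<^sup>m\<close>, on which \<open>P\<close> acts through its transpose.
\<close>

definition bform :: "nat \<Rightarrow> (nat \<Rightarrow> 'a::field bivec) \<Rightarrow> (nat \<Rightarrow> 'a) \<Rightarrow> (nat \<Rightarrow> 'a) \<Rightarrow> nat \<Rightarrow> 'a"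
  where "bform n t x y = (\<lambda>k. \<Sum>i<n. \<Sum>j<n. x i * fst (t k) i j * y j)"

lemma bform_skew:
  assumes "t \<in> XW n m"
  shows "bform n t y x = - bform n t x y"
proof
  fix k
  have sk: "fst (t k) i j = - fst (t k) j i" for i j
  proof (cases "k < m")
    case True
    then have "fst (t k) \<in> alt n" using assms by (auto simp: XW_def Xsp_def ext2_eq)
    then have "fst (t k) i j + fst (t k) j i = 0" by (simp add: alt_def)
    then show ?thesis by (rule eq_neg_iff_add_eq_0[THEN iffD2])
  qed (use assms in \<open>simp add: XW_def\<close>)
  have "bform n t y x k = (\<Sum>i<n. \<Sum>j<n. y j * fst (t k) j i * x i)"
    unfolding bform_def by (rule sum.swap)
  also have "\<dots> = (\<Sum>i<n. \<Sum>j<n. - (x i * fst (t k) i j * y j))"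
  proof (intro sum.cong refl)
    fix i j show "y j * fst (t k) j i * x i = - (x i * fst (t k) i j * y j)"
      unfolding sk[of j i] by (simp add: mult_ac)
  qed
  finally show "bform n t y x k = (- bform n t x y) k"
    by (simp add: bform_def sum_negf)
qed

text \<open>In characteristic 2 this does not follow from \<open>bform_skew\<close>. Off-diagonal
  terms cancel in pairs, and the diagonal terms vanish because the matrix has zero diagonal.\<close>

lemma bform_self:
  assumes "t \<in> XW n m"
  shows "bform n t x x = 0"
proof
  fix k
  show "bform n t x x k = 0 k"
  proof (cases "k < m")
    case True
    then have A: "fst (t k) \<in> alt n" using assms by (auto simp: XW_def Xsp_def ext2_eq)
    define h where "h i j = x i * fst (t k) i j * x j" for i j
    have tri: "(\<Sum>i<r. \<Sum>j<r. h i j) = (\<Sum>j<r. \<Sum>i<j. h i j + h j i) + (\<Sum>j<r. h j j)" for r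
      by (induction r) (simp_all add: sum.distrib algebra_simps)
    have "h j j = 0" for j using A by (simp add: h_def alt_def)
    moreover have "h i j + h j i = 0" for i j
    proof -
      have "h i j + h j i = x i * x j * (fst (t k) i j + fst (t k) j i)"
        by (simp add: h_def algebra_simps)
      then show ?thesis using A by (simp add: alt_def)
    qed
    ultimately show ?thesis using tri[of n] by (simp add: bform_def flip: h_def)
  qed (use assms in \<open>simp add: XW_def bform_def\<close>)
qed

lemma bform_Fn: "t \<in> XW n m \<Longrightarrow> bform n t x y \<in> Fn m"
  by (auto simp: bform_def Fn_def XW_def)

lemma sum_mult_unitv: "j < n \<Longrightarrow> (\<Sum>k<n. f k * unitv j k) = f j"
  and sum_unitv_mult: "j < n \<Longrightarrow> (\<Sum>k<n. unitv j k * f k) = f j"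
proof -
  assume j: "j < n"
  have "(\<Sum>k<n. f k * unitv j k) = (\<Sum>k<n. if k = j then f k else 0)"
    by (intro sum.cong) (auto simp: unitv_def)
  with j show "(\<Sum>k<n. f k * unitv j k) = f j" by simp
  then show "(\<Sum>k<n. unitv j k * f k) = f j" by (simp add: mult.commute)
qed

lemma bform_unitv: "i < n \<Longrightarrow> j < n \<Longrightarrow> bform n t (unitv i) (unitv j) k = fst (t k) i j"
  by (simp add: bform_def sum_mult_unitv sum_unitv_mult)

text \<open>This rests on \<open>x^T (P A P^T) y = (P^T x)^T A (P^T y)\<close>, with
  \<open>Q\<close> acting on the values.\<close>

lemma bform_fixXW:
  assumes t: "t \<in> fixXW n m P Q" and P: "P \<in> carrier_mat n n"
  shows "bform n t x y =
    actV m Q (bform n t (actV n (transpose_mat P) x) (actV n (transpose_mat P) y))"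
proof
  fix k
  let ?S = "actV n (transpose_mat P)"
  have X: "t \<in> XW n m" using t by (simp add: fixXW_def)
  \<comment> \<open>Exchanging sums moves the two indices of \<open>A\<close> outermost; the inner
    sums then become entries of \<open>?S x\<close> and \<open>?S y\<close>.\<close>
  have act: "(\<Sum>i<n. \<Sum>j<n. x i * actM n P A i j * y j) = (\<Sum>c<n. \<Sum>d<n. ?S x c * A c d * ?S y d)" for A
  proof -
    have "(\<Sum>i<n. \<Sum>j<n. x i * actM n P A i j * y j)
        = (\<Sum>i<n. \<Sum>j<n. \<Sum>c<n. \<Sum>d<n. x i * P $$ (i, c) * A c d * P $$ (j, d) * y j)"
      by (intro sum.cong refl) (simp add: actM_def sum_distrib_left sum_distrib_right mult.assoc)
    also have "\<dots> = (\<Sum>i<n. \<Sum>c<n. \<Sum>j<n. \<Sum>d<n. x i * P $$ (i, c) * A c d * P $$ (j, d) * y j)"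
      by (intro sum.cong refl sum.swap)
    also have "\<dots> = (\<Sum>c<n. \<Sum>i<n. \<Sum>d<n. \<Sum>j<n. x i * P $$ (i, c) * A c d * P $$ (j, d) * y j)"
      by (subst sum.swap) (intro sum.cong refl sum.swap)
    also have "\<dots> = (\<Sum>c<n. \<Sum>d<n. \<Sum>i<n. \<Sum>j<n. x i * P $$ (i, c) * A c d * P $$ (j, d) * y j)"
      by (intro sum.cong refl sum.swap)
    also have "\<dots> = (\<Sum>c<n. \<Sum>d<n. ?S x c * A c d * ?S y d)"
    proof (intro sum.cong refl)
      fix c d assume "c \<in> {..<n}" "d \<in> {..<n}"
      then have "?S x c = (\<Sum>i<n. x i * P $$ (i, c))" "?S y d = (\<Sum>j<n. P $$ (j, d) * y j)"
        using P by (auto simp: actV_def mult.commute)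
      then have "?S x c * A c d * ?S y d
          = (\<Sum>i<n. x i * P $$ (i, c)) * A c d * (\<Sum>j<n. P $$ (j, d) * y j)" by simp
      also have "\<dots> = (\<Sum>i<n. \<Sum>j<n. x i * P $$ (i, c) * A c d * P $$ (j, d) * y j)"
        by (simp only: sum_distrib_right) (simp only: sum_distrib_left sum_distrib_right mult.assoc)
      finally show "(\<Sum>i<n. \<Sum>j<n. x i * P $$ (i, c) * A c d * P $$ (j, d) * y j)
          = ?S x c * A c d * ?S y d" by simp
    qed
    finally show ?thesis .
  qed
  show "bform n t x y k = actV m Q (bform n t (?S x) (?S y)) k"
  proof (cases "k < m")
    case True
    have fs: "fst (sum g A) i j = (\<Sum>l\<in>A. fst (g l) i j)" for g :: "nat \<Rightarrow> 'a bivec" and A i j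
      by (induction A rule: infinite_finite_induct) auto
    have "fst (t k) i j = (\<Sum>l<m. Q $$ (k, l) * actM n P (fst (t l)) i j)" for i j
      by (subst fixXW_D[OF t True])
        (simp add: fs scaleX_def scaleM_def actX_def)
    then have "bform n t x y k
        = (\<Sum>i<n. \<Sum>j<n. \<Sum>l<m. x i * (Q $$ (k, l) * actM n P (fst (t l)) i j) * y j)"
      by (simp add: bform_def sum_distrib_left sum_distrib_right)
    also have "\<dots> = (\<Sum>i<n. \<Sum>l<m. \<Sum>j<n. x i * (Q $$ (k, l) * actM n P (fst (t l)) i j) * y j)"
      by (intro sum.cong refl sum.swap)
    also have "\<dots> = (\<Sum>l<m. \<Sum>i<n. \<Sum>j<n. x i * (Q $$ (k, l) * actM n P (fst (t l)) i j) * y j)"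
      by (rule sum.swap)
    also have "\<dots> = (\<Sum>l<m. Q $$ (k, l) * (\<Sum>i<n. \<Sum>j<n. x i * actM n P (fst (t l)) i j * y j))"
      by (simp add: sum_distrib_left mult_ac)
    also have "\<dots> = actV m Q (bform n t (?S x) (?S y)) k"
      using True by (simp add: act actV_def bform_def)
    finally show ?thesis .
  qed (use X in \<open>simp add: bform_def actV_def XW_def\<close>)
qed

text \<open>Lets agreement of two forms pass from a basis to the whole space.\<close>

lemma subspace_bform_eq: "VV.subspace {y. bform n t x y = bform n t' x y}"
proof -
  have add: "bform n t x (y + z) = bform n t x y + bform n t x z" for t y z
    by (simp add: bform_def fun_eq_iff distrib_left sum.distrib)
  have scale: "bform n t x (scaleV c y) = scaleV c (bform n t x y)" for t c y
    by (simp add: bform_def scaleV_def sum_distrib_left mult.left_commute)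
  have zero: "bform n t x 0 = 0" for t
    by (simp add: bform_def fun_eq_iff)
  show ?thesis by (simp add: VV.subspace_def add scale zero)
qed

text \<open>
  Let \<open>S\<close> be the transpose of \<open>P\<close> and \<open>B\<close> a basis containing \<open>F \<union> S F\<close>. For \<open>t\<close> fixed by \<open>(P, Q)\<close> the
  values of the form on \<open>F \<times> B\<close> determine those on \<open>S F \<times> S B\<close>, so the values on the pairs from \<open>S F\<close>
  and \<open>B - F - S F\<close> are redundant.
\<close>

lemma card_fixXW_spread_left:
  fixes P Q :: "'a::{field,finite} mat"
  assumes P: "P \<in> carrier (GL ty n)" and Q: "Q \<in> carrier (GL ty' m)"
    and F: "spread n (actV n (transpose_mat P)) F"
  shows "card (fixXW n m P Q)
    \<le> CARD('a) ^ (m * ((n choose 2) - card F * (n - 2 * card F)) + n * m)"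
proof -
  let ?S = "actV n (transpose_mat P)" and ?k = "card F"
  have S: "?S ` Fn n = Fn n" by (rule actV_image[OF transpose_GL[OF P]])
  have Pc: "P \<in> carrier_mat n n" using P by (simp add: carrier_GL)
  from spread_extends_to_basis[OF F] S obtain B where
    B: "F \<union> ?S ` F \<subseteq> B" "B \<subseteq> Fn n" "finite B" "VV.span B = Fn n" "card B = n" by (metis order_refl)
  define H where "H = ?S ` F"
  have H: "H \<subseteq> B" "finite H" "card H = ?k" "F \<inter> H = {}"
    using B(1,3) card_spread[OF F] F by (auto simp: H_def spread_def intro: finite_subset)
  define R where "R = B - (F \<union> H)"
  have cR: "card R = n - 2 * ?k"
    using B(1,5) finite_subset[OF B(1,3)] card_spread(2)[OF F] by (simp add: R_def H_def card_Diff_subset)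
  have kn: "?k \<le> n" using card_mono[OF B(3) H(1)] H(3) B(5) by simp
  obtain h where h: "bij_betw h {..<?k} H"
    using ex_bij_betw_nat_finite[OF H(2)] H(3) by (auto simp: lessThan_atLeast0)
  have cBH: "card (B - H) = n - ?k" using B H by (simp add: card_Diff_subset)
  obtain g where g: "bij_betw g {?k..<n} (B - H)"
    using finite_same_card_bij[of "{?k..<n}" "B - H"] B(3) cBH by auto
  \<comment> \<open>The vectors of \<open>H\<close> get the indices below \<open>?k\<close>, so each
    redundant pair of a vector of \<open>H\<close> and one of \<open>R\<close> appears as
    \<open>(i, j)\<close> with \<open>i < j\<close>, as in \<open>pairs\<close>.\<close>
  define e where "e i = (if i < ?k then h i else g i)" for i
  have e1: "bij_betw e {..<?k} H"
    using h by (rule bij_betw_cong[THEN iffD1, rotated]) (simp add: e_def)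
  have e2: "bij_betw e {?k..<n} (B - H)"
    using g by (rule bij_betw_cong[THEN iffD1, rotated]) (simp add: e_def)
  have eB: "bij_betw e ({..<?k} \<union> {?k..<n}) (H \<union> (B - H))"
    by (rule bij_betw_combine[OF e1 e2]) auto
  have un: "{..<?k} \<union> {?k..<n} = {..<n}" "H \<union> (B - H) = B" using kn H(1) by auto
  note eB = eB[unfolded un]
  have eH: "e i \<in> H \<longleftrightarrow> i < ?k" if "i < n" for i
  proof (cases "i < ?k")
    case True then show ?thesis using e1 by (auto simp: bij_betw_def)
  next
    case False then have "e i \<in> B - H" using e2 that by (auto simp: bij_betw_def)
    with False show ?thesis by simp
  qed
  define T where "T = {..<?k} \<times> {j. j < n \<and> e j \<in> R}"
  have Tp: "T \<subseteq> pairs n"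
  proof -
    have "?k \<le> j" if "j < n" "e j \<in> R" for j using eH[OF that(1)] that(2) by (auto simp: R_def)
    then show ?thesis by (force simp: T_def pairs_def)
  qed
  have "card {j. j < n \<and> e j \<in> R} = card R"
  proof (rule bij_betw_same_card[of e], rule bij_betw_imageI)
    show "inj_on e {j. j < n \<and> e j \<in> R}" using eB by (auto simp: bij_betw_def inj_on_def)
    have "R \<subseteq> e ` {..<n}" using eB by (auto simp: bij_betw_def R_def)
    then show "e ` {j. j < n \<and> e j \<in> R} = R" by auto
  qed
  then have cT: "card T = ?k * (n - 2 * ?k)" by (simp add: T_def card_cartesian_product cR)
  define J where "J = pairs n - T"
  have fJ: "finite J" by (simp add: J_def finite_pairs)
  have cJ: "card J = (n choose 2) - ?k * (n - 2 * ?k)"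
    using Tp finite_subset[OF Tp finite_pairs]
    by (simp add: J_def card_Diff_subset card_pairs cT)
  \<comment> \<open>A fixed tensor is encoded by its form on the pairs in \<open>J\<close> and its
    whole \<open>V\<close>-component; the latter accounts for the summand \<open>n * m\<close> of
    the exponent.\<close>
  let ?r = "\<lambda>t. (restrict (\<lambda>(i, j). bform n t (e i) (e j)) J, restrict (\<lambda>k. snd (t k)) {..<m})"
  let ?D = "(J \<rightarrow>\<^sub>E (Fn m :: (nat \<Rightarrow> 'a) set)) \<times> ({..<m} \<rightarrow>\<^sub>E (Fn n :: (nat \<Rightarrow> 'a) set))"
  have inj: "inj_on ?r (fixXW n m P Q)"
  proof (rule inj_onI)
    fix t t' assume t: "t \<in> fixXW n m P Q" and t': "t' \<in> fixXW n m P Q" and re: "?r t = ?r t'"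
    have X: "t \<in> XW n m" "t' \<in> XW n m" using t t' by (simp_all add: fixXW_def)
    define agree where "agree x y \<longleftrightarrow> bform n t x y = bform n t' x y" for x y
    have sym: "agree y x" if "agree x y" for x y
      using that by (simp add: agree_def bform_skew[OF X(1), of x y] bform_skew[OF X(2), of x y])
    have span: "agree x y" if "\<And>b. b \<in> B \<Longrightarrow> agree x b" "y \<in> Fn n" for x y
    proof -
      have "VV.span B \<subseteq> {y. bform n t x y = bform n t' x y}"
        using that(1) by (intro VV.span_minimal subspace_bform_eq) (auto simp: agree_def)
      then show ?thesis using that(2) B(4) by (auto simp: agree_def)
    qed
    have J: "agree (e i) (e j)" if "(i, j) \<in> J" for i j
      using fun_cong[OF arg_cong[where f = fst, OF re], of "(i, j)"] that by (simp add: agree_def)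
    have pair: "agree (e i) (e j)" if ij: "i < n" "j < n" and "(i, j) \<notin> T" "(j, i) \<notin> T" for i j
    proof -
      consider "i < j" | "i = j" | "j < i" by linarith
      then show ?thesis
      proof cases
        case 1 then show ?thesis using that by (intro J) (simp add: J_def pairs_def)
      next
        case 2 then show ?thesis by (simp add: agree_def bform_self[OF X(1)] bform_self[OF X(2)])
      next
        case 3 then show ?thesis using that by (intro sym[OF J]) (simp add: J_def pairs_def)
      qed
    qed
    have idx: "\<exists>i<n. b = e i" if "b \<in> B" for b using that eB by (auto simp: bij_betw_def)
    \<comment> \<open>\<open>F\<close> avoids both \<open>H\<close> and \<open>R\<close>, so no pair
      containing \<open>f\<close> has been dropped.\<close>
    have FB: "agree f y" if f: "f \<in> F" and y: "y \<in> Fn n" for f y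
    proof (rule span[OF _ y])
      fix b assume "b \<in> B"
      then obtain j where j: "j < n" "b = e j" using idx by blast
      from f B(1) have "f \<in> B" by blast
      then obtain i where i: "i < n" "f = e i" using idx by blast
      have "f \<notin> H" "f \<notin> R" using f H(4) by (auto simp: R_def)
      then have "(i, j) \<notin> T" "(j, i) \<notin> T" using i eH[OF i(1)] by (auto simp: T_def)
      with i j show "agree f b" by (simp add: pair)
    qed
    \<comment> \<open>As \<open>?S\<close> is onto, \<open>y = ?S u\<close>. The fixed-point
      equation carries agreement at \<open>(f, u)\<close> to agreement at
      \<open>(?S f, ?S u)\<close>, since \<open>Q\<close> is injective.\<close>
    have HB: "agree z y" if z: "z \<in> H" and y: "y \<in> Fn n" for z y
    proof -
      from z obtain f where f: "f \<in> F" "z = ?S f" by (auto simp: H_def)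
      from y S obtain u where u: "u \<in> Fn n" "y = ?S u" by blast
      have "actV m Q (bform n t z y) = actV m Q (bform n t' z y)"
        using FB[OF f(1) u(1)] unfolding agree_def f(2) u(2)
        by (simp flip: bform_fixXW[OF t Pc] bform_fixXW[OF t' Pc])
      then show ?thesis
        unfolding agree_def using inj_onD[OF inj_on_actV[OF Q]] bform_Fn X by blast
    qed
    \<comment> \<open>Pairs meeting \<open>H\<close> are settled by \<open>HB\<close>; all others
      lie outside \<open>T\<close> in both orders.\<close>
    have BB: "agree a b" if a: "a \<in> B" and b: "b \<in> B" for a b
    proof (cases "a \<in> H \<or> b \<in> H")
      case True
      then show ?thesis using HB[of a b] HB[of b a] sym B(2) a b by blast
    next
      case False
      obtain i j where ij: "i < n" "a = e i" "j < n" "b = e j" using idx a b by meson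
      with False have "(i, j) \<notin> T" "(j, i) \<notin> T" using eH by (auto simp: T_def)
      with ij show ?thesis by (simp add: pair)
    qed
    have all: "agree x y" if x: "x \<in> Fn n" and y: "y \<in> Fn n" for x y
    proof (rule span[OF _ y])
      fix b assume "b \<in> B"
      then show "agree x b" using span[OF BB x] sym by blast
    qed
    show "t = t'"
    proof
      fix k
      show "t k = t' k"
      proof (cases "k < m")
        case True
        have "fst (t k) i j = fst (t' k) i j" for i j
        proof (cases "i < n \<and> j < n")
          case True
          with all[OF unitv_Fn unitv_Fn, of i j] have
            "bform n t (unitv i) (unitv j) k = bform n t' (unitv i) (unitv j) k"
            by (simp add: agree_def)
          with True show ?thesis by (simp add: bform_unitv)
        next
          case False
          have "fst (t k) \<in> alt n" "fst (t' k) \<in> alt n"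
            using X True by (auto simp: XW_def Xsp_def ext2_eq)
          with False show ?thesis by (auto simp: alt_def not_less)
        qed
        moreover have "snd (t k) = snd (t' k)"
          using fun_cong[OF arg_cong[where f = snd, OF re], of k] True by simp
        ultimately show ?thesis by (auto simp: prod_eq_iff fun_eq_iff)
      qed (use X in \<open>simp add: XW_def\<close>)
    qed
  qed
  have "?r ` fixXW n m P Q \<subseteq> ?D"
  proof (rule image_subsetI)
    fix t assume "t \<in> fixXW n m P Q"
    then have X: "t \<in> XW n m" by (simp add: fixXW_def)
    then have "snd (t k) \<in> Fn n" if "k < m" for k using that by (auto simp: XW_def Xsp_def)
    with bform_Fn[OF X] show "?r t \<in> ?D" by auto
  qed
  moreover have "finite ?D"
    using fJ by (intro finite_cartesian_product finite_PiE) (auto simp: finite_Fn)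
  ultimately have "card (fixXW n m P Q) \<le> card ?D" using inj by (intro card_inj_on_le)
  also have "\<dots> = CARD('a) ^ (m * ((n choose 2) - ?k * (n - 2 * ?k)) + n * m)"
    using fJ by (simp add: card_cartesian_product card_funcsetE card_Fn cJ power_add power_mult)
  finally show ?thesis .
qed

section \<open>Pairs of scalar matrices\<close>

lemma actV_scalar_imp_eq:
  assumes M: "M \<in> carrier_mat n n" and a: "\<And>x. x \<in> Fn n \<Longrightarrow> actV n M x = scaleV a x"
  shows "M = a \<cdot>\<^sub>m 1\<^sub>m n"
proof (rule eq_matI)
  fix i j assume "i < dim_row (a \<cdot>\<^sub>m 1\<^sub>m n)" "j < dim_col (a \<cdot>\<^sub>m 1\<^sub>m n)"
  then have i: "i < n" and j: "j < n" by auto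
  have "(\<Sum>k<n. M $$ (i, k) * unitv j k) = (\<Sum>k<n. if k = j then M $$ (i, k) else 0)"
    by (intro sum.cong) (auto simp: unitv_def)
  then have "actV n M (unitv j) i = M $$ (i, j)" using i j by (simp add: actV_def)
  with a[OF unitv_Fn[OF j]] show "M $$ (i, j) = (a \<cdot>\<^sub>m 1\<^sub>m n) $$ (i, j)"
    using i j by (auto simp: scaleV_def unitv_def)
qed (use M in auto)

lemma actX_scalar:
  assumes "x \<in> Xsp n"
  shows "actX n (a \<cdot>\<^sub>m 1\<^sub>m n) x = (scaleM (a * a) (fst x), scaleV a (snd x))"
proof -
  have A: "fst x \<in> alt n" "snd x \<in> Fn n" using assms by (auto simp: Xsp_def ext2_eq)
  have "actM n (a \<cdot>\<^sub>m 1\<^sub>m n) (fst x) = scaleM (a * a) (fst x)"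
  proof (intro ext)
    fix i j
    show "actM n (a \<cdot>\<^sub>m 1\<^sub>m n) (fst x) i j = scaleM (a * a) (fst x) i j"
    proof (cases "i < n \<and> j < n")
      case True
      have one: "(a \<cdot>\<^sub>m 1\<^sub>m n) $$ (r, k) = a * unitv r k" if "r < n" "k < n" for r k
        using that by (auto simp: unitv_def)
      have "actM n (a \<cdot>\<^sub>m 1\<^sub>m n) (fst x) i j
          = (\<Sum>k<n. \<Sum>l<n. (a \<cdot>\<^sub>m 1\<^sub>m n) $$ (i, k) * fst x k l * (a \<cdot>\<^sub>m 1\<^sub>m n) $$ (j, l))"
        using True by (simp add: actM_def)
      also have "\<dots> = (\<Sum>k<n. \<Sum>l<n. a * unitv i k * fst x k l * (a * unitv j l))"
        using True by (intro sum.cong refl) (simp only: one lessThan_iff)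
      also have "\<dots> = (\<Sum>k<n. unitv i k * (\<Sum>l<n. a * a * fst x k l * unitv j l))"
        by (simp add: sum_distrib_left mult_ac)
      finally show ?thesis
        using True by (simp add: sum_mult_unitv sum_unitv_mult scaleM_def)
    qed (use A in \<open>auto simp: actM_def scaleM_def alt_def not_less\<close>)
  qed
  moreover have "actV n (a \<cdot>\<^sub>m 1\<^sub>m n) (snd x) = scaleV a (snd x)"
  proof
    fix i
    have "(\<Sum>k<n. (a \<cdot>\<^sub>m 1\<^sub>m n) $$ (i, k) * snd x k) = (\<Sum>k<n. if k = i then a * snd x k else 0)"
      if "i < n" using that by (intro sum.cong refl) auto
    then show "actV n (a \<cdot>\<^sub>m 1\<^sub>m n) (snd x) i = scaleV a (snd x) i"
      using A(2) by (auto simp: actV_def scaleV_def Fn_def not_less)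
  qed
  ultimately show ?thesis by (simp add: actX_def map_prod_def case_prod_unfold)
qed

lemma fixXW_scalar:
  assumes t: "t \<in> fixXW n m (a \<cdot>\<^sub>m 1\<^sub>m n) (b \<cdot>\<^sub>m 1\<^sub>m m)" and k: "k < m"
  shows "fst (t k) = scaleM (b * (a * a)) (fst (t k))" "snd (t k) = scaleV (b * a) (snd (t k))"
proof -
  have x: "t k \<in> Xsp n" using t k by (simp add: fixXW_def XW_def)
  have "t k = (\<Sum>l<m. scaleX ((b \<cdot>\<^sub>m 1\<^sub>m m) $$ (k, l)) (actX n (a \<cdot>\<^sub>m 1\<^sub>m n) (t l)))"
    by (rule fixXW_D[OF t k])
  also have "\<dots> = (\<Sum>l<m. if l = k then scaleX b (actX n (a \<cdot>\<^sub>m 1\<^sub>m n) (t l)) else 0)"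
    using k by (intro sum.cong refl) auto
  also have "\<dots> = scaleX b (actX n (a \<cdot>\<^sub>m 1\<^sub>m n) (t k))" using k by simp
  finally have "t k = scaleX b (actX n (a \<cdot>\<^sub>m 1\<^sub>m n) (t k))" .
  then have "t k = (scaleM (b * (a * a)) (fst (t k)), scaleV (b * a) (snd (t k)))"
    unfolding actX_scalar[OF x] by (simp add: scaleX_def scaleM_def scaleV_def mult.assoc)
  then show "fst (t k) = scaleM (b * (a * a)) (fst (t k))" "snd (t k) = scaleV (b * a) (snd (t k))"
    by (metis fst_conv, metis snd_conv)
qed

text \<open>The pair acts by \<open>b * (a * a)\<close> and \<open>b * a\<close> on the two
  summands. If both were 1, then \<open>a = b = 1\<close>. So one component of every fixed tensor
  vanishes, and the maximum covers either case.\<close>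

lemma card_fixXW_scalar:
  fixes a b :: "'a::{field,finite}"
  assumes "a \<noteq> 1 \<or> b \<noteq> 1"
  shows "card (fixXW n m (a \<cdot>\<^sub>m 1\<^sub>m n) (b \<cdot>\<^sub>m 1\<^sub>m m)) \<le> CARD('a) ^ (max (n choose 2) n * m)"
proof -
  let ?X = "fixXW n m (a \<cdot>\<^sub>m 1\<^sub>m n) (b \<cdot>\<^sub>m 1\<^sub>m m)"
  have X: "fst (t k) \<in> ext2 n" "snd (t k) \<in> Fn n" if "t \<in> ?X" "k < m" for t k
    using that by (auto simp: fixXW_def XW_def Xsp_def)
  have z: "t k = 0" if "t \<in> ?X" "\<not> k < m" for t k using that by (simp add: fixXW_def XW_def)
  have q: "1 \<le> CARD('a)" by (simp add: Suc_leI)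
  show ?thesis
  proof (cases "b * a = 1")
    case False
    have s0: "snd (t k) = 0" if "t \<in> ?X" "k < m" for t k
    proof
      fix i
      have "snd (t k) i = b * a * snd (t k) i"
        using fun_cong[OF fixXW_scalar(2)[OF that], of i] by (simp add: scaleV_def)
      then show "snd (t k) i = 0 i" using False by simp
    qed
    have "inj_on (\<lambda>t. restrict (\<lambda>k. fst (t k)) {..<m}) ?X"
    proof (rule inj_onI, rule ext)
      fix t t' k assume t: "t \<in> ?X" "t' \<in> ?X"
        and e: "restrict (\<lambda>k. fst (t k)) {..<m} = restrict (\<lambda>k. fst (t' k)) {..<m}"
      show "t k = t' k"
        using fun_cong[OF e, of k] s0[of _ k] z[of _ k] t by (cases "k < m") (auto simp: prod_eq_iff)
    qed
    moreover have "(\<lambda>t. restrict (\<lambda>k. fst (t k)) {..<m}) ` ?X \<subseteq> {..<m} \<rightarrow>\<^sub>E ext2 n" using X by auto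
    moreover have "finite ({..<m} \<rightarrow>\<^sub>E (ext2 n :: (nat \<Rightarrow> nat \<Rightarrow> 'a) set))"
      using card_ge_0_finite[of "ext2 n :: (nat \<Rightarrow> nat \<Rightarrow> 'a) set"] by (intro finite_PiE) (simp_all add: card_ext2)
    ultimately have "card ?X \<le> card ({..<m} \<rightarrow>\<^sub>E (ext2 n :: (nat \<Rightarrow> nat \<Rightarrow> 'a) set))"
      by (rule card_inj_on_le)
    also have "\<dots> = CARD('a) ^ ((n choose 2) * m)" by (simp add: card_funcsetE card_ext2 power_mult)
    also have "\<dots> \<le> CARD('a) ^ (max (n choose 2) n * m)"
      by (intro power_increasing q mult_le_mono1) simp
    finally show ?thesis .
  next
    case True
    have ne: "b * (a * a) \<noteq> 1"
    proof
      assume "b * (a * a) = 1"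
      then have "(b * a) * a = 1" by (simp add: mult.assoc)
      with True assms show False by simp
    qed
    have s0: "fst (t k) = 0" if "t \<in> ?X" "k < m" for t k
    proof (intro ext)
      fix i j
      have "fst (t k) i j = b * (a * a) * fst (t k) i j"
        using fun_cong[OF fun_cong[OF fixXW_scalar(1)[OF that], of i], of j] by (simp add: scaleM_def)
      then show "fst (t k) i j = 0 i j" using ne by simp
    qed
    have "inj_on (\<lambda>t. restrict (\<lambda>k. snd (t k)) {..<m}) ?X"
    proof (rule inj_onI, rule ext)
      fix t t' k assume t: "t \<in> ?X" "t' \<in> ?X"
        and e: "restrict (\<lambda>k. snd (t k)) {..<m} = restrict (\<lambda>k. snd (t' k)) {..<m}"
      show "t k = t' k"
        using fun_cong[OF e, of k] s0[of _ k] z[of _ k] t by (cases "k < m") (auto simp: prod_eq_iff)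
    qed
    moreover have "(\<lambda>t. restrict (\<lambda>k. snd (t k)) {..<m}) ` ?X \<subseteq> {..<m} \<rightarrow>\<^sub>E Fn n" using X by auto
    moreover have "finite ({..<m} \<rightarrow>\<^sub>E (Fn n :: (nat \<Rightarrow> 'a) set))"
      by (intro finite_PiE) (simp_all add: finite_Fn)
    ultimately have "card ?X \<le> card ({..<m} \<rightarrow>\<^sub>E (Fn n :: (nat \<Rightarrow> 'a) set))"
      by (rule card_inj_on_le)
    also have "\<dots> = CARD('a) ^ (n * m)" by (simp add: card_funcsetE card_Fn power_mult)
    also have "\<dots> \<le> CARD('a) ^ (max (n choose 2) n * m)"
      by (intro power_increasing q mult_le_mono1) simp
    finally show ?thesis .
  qed
qed

section \<open>Counting orbits\<close>

lemma two_times_choose_two: "2 * (n choose 2) = n * (n - 1)"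
proof -
  have "even (n * (n - 1))" by (cases n) auto
  then show ?thesis unfolding choose_two by (rule dvd_mult_div_cancel)
qed

text \<open>Keeps the subtraction in the exponent of \<open>card_fixXW_spread_left\<close> from
  being truncated. After doubling, the factors \<open>2 * K\<close> and \<open>n - 2 * K\<close> are
  at most \<open>n - 1\<close> and \<open>n\<close>.\<close>

lemma mult_diff_le_choose_two:
  fixes n K :: nat
  assumes "2 * K < n"
  shows "K * (n - 2 * K) \<le> n choose 2"
proof -
  have "2 * (K * (n - 2 * K)) = (2 * K) * (n - 2 * K)" by simp
  also have "\<dots> \<le> (n - 1) * n" using assms by (intro mult_le_mono) auto
  finally show ?thesis unfolding choose_two by (simp add: mult.commute)
qed

lemma exponent_diff:
  fixes c m n y :: nat
  assumes "y \<le> c"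
  shows "m * (c - y) + n * m = (c + n) * m - m * y"
proof -
  from assms obtain z where "c = y + z" by (auto simp: le_iff_add)
  then show ?thesis by (simp add: algebra_simps)
qed

section \<open>Losses of single group elements\<close>

lemma card_fixXW_le:
  "card (fixXW n m P Q :: (nat \<Rightarrow> 'a::{field,finite} bivec) set) \<le> CARD('a) ^ (((n choose 2) + n) * m)"
  unfolding card_XW[symmetric] by (rule card_mono[OF finite_XW]) (auto simp: fixXW_def)

lemma one_le_CARD: "1 \<le> CARD('a::{field,finite})"
  by (simp add: Suc_leI)

text \<open>\<open>D\<close> is a loss guaranteed on either side: \<open>K\<close> spread vectors
  for \<open>Q\<close> remove \<open>K\<close> copies of \<open>Xsp n\<close>, and \<open>K\<close>
  for \<open>P\<close> remove \<open>K * (n - 2 * K)\<close> values in \<open>Fn m\<close>.\<close>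

lemma card_fixXW_far:
  fixes P Q :: "'a::{field,finite} mat"
  assumes P: "P \<in> carrier (GL ty n)" and Q: "Q \<in> carrier (GL ty' m)"
    and far: "transpose_mat P \<notin> near_scalar n (2 * K) \<or> transpose_mat Q \<notin> near_scalar m (2 * K)"
    and K: "0 < K" "2 * K < n"
    and D: "D \<le> ((n choose 2) + n) * K" "D \<le> m * (K * (n - 2 * K))"
  shows "card (fixXW n m P Q) \<le> CARD('a) ^ (((n choose 2) + n) * m - D)"
proof -
  let ?N = "(n choose 2) + n"
  have Pc: "transpose_mat P \<in> carrier_mat n n" and Qc: "Q \<in> carrier_mat m m" "transpose_mat Q \<in> carrier_mat m m"
    using P Q by (simp_all add: carrier_GL)
  from far show ?thesis
  proof
    assume "transpose_mat P \<notin> near_scalar n (2 * K)"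
    from spread_or_mem_near_scalar[OF Pc this K(1)] obtain F where
      F: "spread n (actV n (transpose_mat P)) F" "card F = K" by blast
    have "m * ((n choose 2) - K * (n - 2 * K)) + n * m = ?N * m - m * (K * (n - 2 * K))"
      by (rule exponent_diff[OF mult_diff_le_choose_two[OF K(2)]])
    also have "\<dots> \<le> ?N * m - D" using D(2) by (rule diff_le_mono2)
    finally have "m * ((n choose 2) - card F * (n - 2 * card F)) + n * m \<le> ?N * m - D"
      by (simp only: F(2))
    from order_trans[OF card_fixXW_spread_left[OF P Q F(1)] power_increasing[OF this one_le_CARD]]
    show ?thesis .
  next
    assume "transpose_mat Q \<notin> near_scalar m (2 * K)"
    from spread_or_mem_near_scalar[OF Qc(2) this K(1)] obtain F where
      F: "spread m (actV m (transpose_mat Q)) F" "card F = K" by blast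
    have "?N * (m - card F) \<le> ?N * m - D"
      unfolding diff_mult_distrib2 F(2) using D(1) by (rule diff_le_mono2)
    from order_trans[OF card_fixXW_spread_right[OF P Qc(1) F(1)] power_increasing[OF this one_le_CARD]]
    show ?thesis .
  qed
qed

text \<open>One spread vector costs \<open>m * (n - 2)\<close> dimensions for \<open>P\<close> and a
  copy of \<open>Xsp n\<close> for \<open>Q\<close>. If there is none, both matrices are scalar and
  at least the smaller summand, tensored with \<open>W\<close>, is lost.\<close>

lemma card_fixXW_nonidentity:
  fixes P Q :: "'a::{field,finite} mat"
  assumes P: "P \<in> carrier (GL ty n)" and Q: "Q \<in> carrier (GL ty' m)"
    and ne: "(P, Q) \<noteq> (1\<^sub>m n, 1\<^sub>m m)" and n: "2 < n"
    and d: "d \<le> (n choose 2) + n" "d \<le> m * (n - 2)" "d \<le> min (n choose 2) n * m"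
  shows "card (fixXW n m P Q) \<le> CARD('a) ^ (((n choose 2) + n) * m - d)"
proof -
  let ?N = "(n choose 2) + n"
  let ?SP = "actV n (transpose_mat P)" and ?SQ = "actV m (transpose_mat Q)"
  have Pc: "P \<in> carrier_mat n n" and Qc: "Q \<in> carrier_mat m m"
    using P Q by (simp_all add: carrier_GL)
  have im: "actV k M ` Fn k \<subseteq> Fn k" for k and M :: "'a mat" by (auto simp: actV_Fn)
  note up = power_increasing[OF _ one_le_CARD]
  consider (P) x where "spread n ?SP {x}" | (Q) x where "spread m ?SQ {x}"
    | (scalar) a b where "\<And>x. x \<in> Fn n \<Longrightarrow> ?SP x = scaleV a x" "\<And>x. x \<in> Fn m \<Longrightarrow> ?SQ x = scaleV b x"
    using spread_or_scalar[OF linear_actV im] by metis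
  then show ?thesis
  proof cases
    case P': P
    have "m * ((n choose 2) - 1 * (n - 2 * 1)) + n * m = ?N * m - m * (1 * (n - 2 * 1))"
      by (rule exponent_diff[OF mult_diff_le_choose_two]) (use n in simp)
    also have "\<dots> \<le> ?N * m - d" using d(2) by simp
    finally have "m * ((n choose 2) - card {x} * (n - 2 * card {x})) + n * m \<le> ?N * m - d" by simp
    from order_trans[OF card_fixXW_spread_left[OF P Q P'] up[OF this]] show ?thesis .
  next
    case Q': Q
    have "?N * (m - card {x}) \<le> ?N * m - d"
      unfolding diff_mult_distrib2 using d(1) by (simp add: diff_le_mono2)
    from order_trans[OF card_fixXW_spread_right[OF P Qc Q'] up[OF this]] show ?thesis .
  next
    case scalar
    have "transpose_mat P = a \<cdot>\<^sub>m 1\<^sub>m n" "transpose_mat Q = b \<cdot>\<^sub>m 1\<^sub>m m"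
      using actV_scalar_imp_eq[of _ n a] actV_scalar_imp_eq[of _ m b] scalar Pc Qc by simp_all
    then have PQ: "P = a \<cdot>\<^sub>m 1\<^sub>m n" "Q = b \<cdot>\<^sub>m 1\<^sub>m m"
      using transpose_transpose[of P] transpose_transpose[of Q] by (auto simp: transpose_one intro!: eq_matI)
    then have "a \<noteq> 1 \<or> b \<noteq> 1" using ne by auto
    from card_fixXW_scalar[OF this]
    have "card (fixXW n m P Q) \<le> CARD('a) ^ (max (n choose 2) n * m)" by (simp add: PQ)
    also have "max (n choose 2) n * m \<le> ?N * m - d"
    proof -
      have "max (n choose 2) n * m + min (n choose 2) n * m = ?N * m"
        by (simp add: max_def min_def algebra_simps)
      then show ?thesis using d(3) by linarith
    qed
    then have "CARD('a) ^ (max (n choose 2) n * m) \<le> CARD('a) ^ (?N * m - d)" by (rule up)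
    finally show ?thesis .
  qed
qed

section \<open>The Burnside sum\<close>

lemma sum_Un_le:
  fixes f :: "'b \<Rightarrow> nat"
  shows "finite A \<Longrightarrow> finite B \<Longrightarrow> sum f (A \<union> B) \<le> sum f A + sum f B"
  by (simp add: sum_Un_nat)

text \<open>The three terms come from the identity, from the other pairs with both transposes near
  scalar (few, of loss \<open>d\<close>), and from the remaining pairs (bounded by the whole group,
  of loss \<open>D\<close>).\<close>

lemma sum_card_fixXW_le:
  fixes ty :: "'a::{field,finite} itself"
  assumes n: "2 < n" and K: "0 < K" "2 * K < n"
    and D: "D \<le> ((n choose 2) + n) * K" "D \<le> m * (K * (n - 2 * K))"
    and d: "d \<le> (n choose 2) + n" "d \<le> m * (n - 2)" "d \<le> min (n choose 2) n * m"
  shows "(\<Sum>(P, Q)\<in>carrier (GL ty n) \<times> carrier (GL ty m). card (fixXW n m P Q))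
    \<le> CARD('a) ^ (((n choose 2) + n) * m)
      + CARD('a) ^ (2 + 4 * K * (n + m)) * CARD('a) ^ (((n choose 2) + n) * m - d)
      + CARD('a) ^ (n ^ 2 + m ^ 2) * CARD('a) ^ (((n choose 2) + n) * m - D)"
proof -
  let ?N = "(n choose 2) + n" and ?q = "CARD('a)"
  let ?G = "carrier (GL ty n) \<times> carrier (GL ty m)"
  let ?f = "\<lambda>(P :: 'a mat, Q :: 'a mat). card (fixXW n m P Q)"
  define A where "A = {(P, Q). transpose_mat P \<in> near_scalar n (2 * K) \<and>
    transpose_mat Q \<in> (near_scalar m (2 * K) :: 'a mat set)} \<inter> ?G"
  let ?A = "A - {(1\<^sub>m n, 1\<^sub>m m)}"
  have fG: "finite ?G" by (simp add: finite_carrier_GL)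
  have fA: "finite A" using fG by (simp add: A_def)
  have cG: "card ?G \<le> ?q ^ (n ^ 2 + m ^ 2)"
    using mult_le_mono[OF order_GL_le[of ty n] order_GL_le[of ty m]]
    by (simp add: card_cartesian_product order_def power_add)
  \<comment> \<open>Nearness is imposed on the transposes, and transposing is injective.\<close>
  have "card A \<le> card ((near_scalar n (2 * K) :: 'a mat set) \<times> (near_scalar m (2 * K) :: 'a mat set))"
  proof (rule card_inj_on_le)
    show "inj_on (map_prod transpose_mat transpose_mat) A"
      by (rule inj_on_inverseI[where g = "map_prod transpose_mat transpose_mat"]) auto
  qed (auto simp: A_def finite_near_scalar)
  also have "\<dots> \<le> ?q ^ (1 + 2 * (2 * K) * n) * ?q ^ (1 + 2 * (2 * K) * m)"
    unfolding card_cartesian_product by (intro mult_le_mono card_near_scalar)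
  also have "\<dots> = ?q ^ (2 + 4 * K * (n + m))"
    by (simp add: algebra_simps flip: power_add)
  finally have cA: "card A \<le> ?q ^ (2 + 4 * K * (n + m))" .
  have "sum ?f ?G \<le> sum ?f ({(1\<^sub>m n, 1\<^sub>m m)} \<union> (?A \<union> (?G - A)))"
    by (rule sum_mono2) (use fG fA in auto)
  also have "\<dots> \<le> sum ?f {(1\<^sub>m n, 1\<^sub>m m)} + sum ?f (?A \<union> (?G - A))"
    by (rule sum_Un_le) (use fG fA in auto)
  also have "sum ?f (?A \<union> (?G - A)) = sum ?f ?A + sum ?f (?G - A)"
    using fG fA by (intro sum.union_disjoint) auto
  also have "sum ?f {(1\<^sub>m n, 1\<^sub>m m)} \<le> ?q ^ (?N * m)"
    using card_fixXW_le by simp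
  also have "sum ?f ?A \<le> card A * ?q ^ (?N * m - d)"
  proof -
    have "sum ?f ?A \<le> of_nat (card ?A) * ?q ^ (?N * m - d)"
      by (rule sum_bounded_above)
        (auto simp: A_def intro!: card_fixXW_nonidentity[OF _ _ _ n d])
    also have "\<dots> \<le> card A * ?q ^ (?N * m - d)"
      using card_mono[OF fA, of ?A] by simp
    finally show ?thesis .
  qed
  also have "sum ?f (?G - A) \<le> card ?G * ?q ^ (?N * m - D)"
  proof -
    have "sum ?f (?G - A) \<le> of_nat (card (?G - A)) * ?q ^ (?N * m - D)"
      by (rule sum_bounded_above)
        (auto simp: A_def intro!: card_fixXW_far[OF _ _ _ K D])
    also have "\<dots> \<le> card ?G * ?q ^ (?N * m - D)"
      using card_mono[OF fG, of "?G - A"] by simp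
    finally show ?thesis .
  qed
  also have "card A * ?q ^ (?N * m - d) \<le> ?q ^ (2 + 4 * K * (n + m)) * ?q ^ (?N * m - d)"
    using cA by (rule mult_le_mono1)
  also have "card ?G * ?q ^ (?N * m - D) \<le> ?q ^ (n ^ 2 + m ^ 2) * ?q ^ (?N * m - D)"
    using cG by (rule mult_le_mono1)
  finally show ?thesis by (simp add: add.assoc)
qed

lemma g_tensor_burnside:
  fixes ty :: "'a::{field,finite} itself"
  shows "g_tensor ty n m * (order (GL ty n) * order (GL ty m)) =
    (\<Sum>(P, Q)\<in>carrier (GL ty n) \<times> carrier (GL ty m). card (fixXW n m P Q))"
proof -
  let ?\<phi> = "\<lambda>PQ. \<lambda>t\<in>XW n m. actXW n m PQ t"
  interpret group_action "GL ty n \<times>\<times> GL ty m" "XW n m" ?\<phi> by (rule group_action_XW)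
  have c: "carrier (GL ty n \<times>\<times> GL ty m) = carrier (GL ty n) \<times> carrier (GL ty m)"
    by (simp add: DirProd_def)
  have inv: "invariants (XW n m) ?\<phi> (P, Q) = fixXW n m P Q" for P Q :: "'a mat"
    by (auto simp: invariants_def fixXW_def)
  have "(\<Sum>PQ\<in>carrier (GL ty n) \<times> carrier (GL ty m). card (invariants (XW n m) ?\<phi> PQ)) =
      (\<Sum>(P, Q)\<in>carrier (GL ty n) \<times> carrier (GL ty m). card (fixXW n m P Q))"
    by (intro sum.cong refl) (simp only: split_paired_all inv case_prod_conv)
  moreover have "order (GL ty n \<times>\<times> GL ty m) = order (GL ty n) * order (GL ty m)"
    by (simp add: order_def c card_cartesian_product)
  ultimately show ?thesis
    using burnside[OF _ finite_XW] by (simp add: g_tensor_def c finite_carrier_GL)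
qed

text \<open>Serves to compare numbers of orbits, with \<open>A\<close> and \<open>B\<close> the
  orbit maps. The class of \<open>x\<close> is recovered from that of \<open>f x\<close> by choosing
  any preimage.\<close>

lemma card_image_le_card_image:
  assumes "finite E'" "f ` E \<subseteq> E'"
    and "\<And>x y. x \<in> E \<Longrightarrow> y \<in> E \<Longrightarrow> B (f x) = B (f y) \<Longrightarrow> A x = A y"
  shows "card (A ` E) \<le> card (B ` E')"
proof -
  define h where "h b = A (SOME x. x \<in> E \<and> B (f x) = b)" for b
  have "A x = h (B (f x))" if x: "x \<in> E" for x
  proof -
    have "(SOME z. z \<in> E \<and> B (f z) = B (f x)) \<in> E \<and> B (f (SOME z. z \<in> E \<and> B (f z) = B (f x))) = B (f x)"
      by (rule someI[where x = x]) (use x in simp)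
    then show ?thesis unfolding h_def using assms(3) x by metis
  qed
  then have "A ` E \<subseteq> h ` B ` E'" using assms(2) by (simp add: image_subset_iff)
  then show ?thesis using surj_card_le[of "B ` E'" "A ` E" h] assms(1) by simp
qed

lemma card_of_Gr:
  assumes "U \<in> Gr n m"
  shows "card (U :: 'a::{field,finite} bivec set) = CARD('a) ^ m"
proof -
  from assms have U: "VX.subspace U" "U \<subseteq> Xsp n" "VX.dim U = m" by (auto simp: Gr_def)
  obtain B where B: "B \<subseteq> U" "VX.independent B" "U \<subseteq> VX.span B" "card B = VX.dim U"
    by (rule VX.basis_exists)
  have "finite B" by (rule finite_subset[OF subset_trans[OF B(1) U(2)] finite_Xsp])
  from card_span_independent[OF vector_space_scaleX this B(2)] show ?thesis
    using span_eq_self[OF vector_space_scaleX U(1) B(1,3)] B(4) U(3) by simp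
qed

text \<open>Attach to each subspace a spanning \<open>m\<close>-tuple. If \<open>(P, Q)\<close>
  carries the tuple of \<open>U\<close> to that of \<open>U'\<close>, then \<open>Q\<close> only
  recombines the entries, so \<open>P\<close> carries \<open>U\<close> to \<open>U'\<close>. Hence
  the orbit of the tuple determines that of the subspace.\<close>

lemma g_Gr_le_g_tensor: "g_Gr (ty :: 'a::{field,finite} itself) n m \<le> g_tensor ty n m"
proof -
  let ?\<phi> = "\<lambda>P. \<lambda>U\<in>Gr n m. actX n P ` U"
  let ?\<psi> = "\<lambda>PQ. \<lambda>t\<in>XW n m. actXW n m PQ t"
  interpret A: group_action "GL ty n" "Gr n m" ?\<phi> by (rule group_action_Gr)
  interpret T: group_action "GL ty n \<times>\<times> GL ty m" "XW n m" ?\<psi> by (rule group_action_XW)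
  have ex: "\<exists>t. t \<in> XW n m \<and> VX.span (t ` {..<m}) = U" if Gr: "U \<in> Gr n m" for U :: "'a bivec set"
  proof -
    from Gr have U: "VX.subspace U" "U \<subseteq> Xsp n" "VX.dim U = m" by (auto simp: Gr_def)
    obtain B where B: "B \<subseteq> U" "VX.independent B" "U \<subseteq> VX.span B" "card B = VX.dim U"
      by (rule VX.basis_exists)
    have "finite B" by (rule finite_subset[OF subset_trans[OF B(1) U(2)] finite_Xsp])
    then obtain h where h: "bij_betw h {..<m} B"
      using ex_bij_betw_nat_finite[of B] B(4) U(3) by (auto simp: lessThan_atLeast0)
    define t where "t k = (if k < m then h k else 0)" for k
    have "t ` {..<m} = B" using h by (auto simp: t_def bij_betw_def)
    moreover from this have "t \<in> XW n m" using B(1) U(2) by (auto simp: XW_def t_def)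
    ultimately show ?thesis using span_eq_self[OF vector_space_scaleX U(1) B(1,3)] by blast
  qed
  define \<tau> where "\<tau> U = (SOME t. t \<in> XW n m \<and> VX.span (t ` {..<m}) = U)" for U :: "'a bivec set"
  have \<tau>: "\<tau> U \<in> XW n m" "VX.span (\<tau> U ` {..<m}) = U" if "U \<in> Gr n m" for U
    using someI_ex[OF ex[OF that]] by (simp_all add: \<tau>_def)
  have "card (orbit (GL ty n) ?\<phi> ` Gr n m) \<le> card (orbit (GL ty n \<times>\<times> GL ty m) ?\<psi> ` XW n m)"
  proof (rule card_image_le_card_image[OF finite_XW])
    show "\<tau> ` Gr n m \<subseteq> XW n m" using \<tau> by blast
    fix U U' :: "'a bivec set" assume U: "U \<in> Gr n m" "U' \<in> Gr n m"
      and "orbit (GL ty n \<times>\<times> GL ty m) ?\<psi> (\<tau> U) = orbit (GL ty n \<times>\<times> GL ty m) ?\<psi> (\<tau> U')"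
    then have "\<tau> U' \<in> orbit (GL ty n \<times>\<times> GL ty m) ?\<psi> (\<tau> U)"
      using T.orbit_refl[OF \<tau>(1)[OF U(2)]] by simp
    then obtain P Q where P: "P \<in> carrier (GL ty n)" and e: "\<tau> U' = actXW n m (P, Q) (\<tau> U)"
      using \<tau>(1)[OF U(1)] by (auto simp: orbit_def DirProd_def)
    have PU: "actX n P ` U \<in> Gr n m" by (rule actX_image_Gr[OF P U(1)])
    then have sub: "VX.subspace (actX n P ` U)" by (simp add: Gr_def)
    have "\<tau> U l \<in> U" if "l < m" for l
      using \<tau>(2)[OF U(1)] VX.span_base[of "\<tau> U l" "\<tau> U ` {..<m}"] that by blast
    then have "\<tau> U' ` {..<m} \<subseteq> actX n P ` U"
      by (auto simp: e actXW_def intro!: VX.subspace_sum[OF sub] VX.subspace_scale[OF sub])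
    then have "U' \<subseteq> actX n P ` U"
      using VX.span_minimal[OF _ sub] \<tau>(2)[OF U(2)] by blast
    moreover have "finite (actX n P ` U)" using PU finite_Xsp[of n] by (auto simp: Gr_def intro: finite_subset)
    \<comment> \<open>Inclusion suffices, as both sides are finite with \<open>CARD('a) ^ m\<close>
      elements.\<close>
    ultimately have "U' = actX n P ` U"
      using card_of_Gr[OF PU] card_of_Gr[OF U(2)] by (intro card_subset_eq) auto
    then have "U' \<in> orbit (GL ty n) ?\<phi> U" using P U(1) by (auto simp: orbit_def)
    moreover have "U' \<in> orbit (GL ty n) ?\<phi> U'" by (rule A.orbit_refl[OF U(2)])
    ultimately show "orbit (GL ty n) ?\<phi> U = orbit (GL ty n) ?\<phi> U'"
      using A.disjoint_union U unfolding orbits_def by blast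
  qed
  then show ?thesis
    by (simp add: g_Gr_def g_tensor_def orbits_def Setcompr_eq_image)
qed

text \<open>Here \<open>b\<close> bounds the ratio of \<open>n\<close> and \<open>m\<close> in both
  directions. The number of near-scalar pairs has an exponent linear in \<open>n\<close>, against
  the quadratic loss \<open>d\<close>; the constant \<open>K\<close> makes the loss \<open>D\<close>
  of far pairs exceed the exponent of the group order by \<open>n ^ 2\<close>.\<close>

lemma g_tensor_upper:
  fixes ty :: "'a::{field,finite} itself" and n m b :: nat
  defines "K \<equiv> 2 * b * (2 + b ^ 2)"
  assumes b: "1 \<le> b" "n \<le> b * m" "m \<le> b * n"
    and n: "16 * b + 16 * b * K * (1 + b) \<le> n"
  shows "real (g_tensor ty n m) * (real (order (GL ty n)) * real (order (GL ty m)))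
    \<le> real CARD('a) ^ (((n choose 2) + n) * m) * (1 + real CARD('a) powr (- (1 / (8 * real b)) * real n ^ 2))"
proof -
  let ?q = "CARD('a)" and ?N = "(n choose 2) + n"
  have q2: "2 \<le> ?q"
    using card_mono[of "UNIV :: 'a set" "{0,1}"] by simp
  have K: "0 < K" using b(1) by (simp add: K_def)
  have n16: "16 \<le> n" "16 * b \<le> n" using n b(1) by linarith+
  have nK: "16 * K \<le> n"
  proof -
    have "16 * K * 1 \<le> 16 * K * (b * (1 + b))" using b(1) by (intro mult_le_mono2) simp
    also have "\<dots> = 16 * b * K * (1 + b)" by (simp only: mult_ac)
    also have "\<dots> \<le> n" using n by linarith
    finally show ?thesis by simp
  qed
  note two_C = two_times_choose_two[of n]
  have two_N: "2 * ?N = n * (n + 1)"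
    unfolding distrib_left two_C using n16 by (cases n) simp_all
  \<comment> \<open>The saving to be proved is \<open>e\<close>, about half of the loss
    \<open>d\<close>. In \<open>D\<close> the part \<open>n ^ 2 + m ^ 2\<close> pays for the number
    of group elements and the second \<open>n ^ 2\<close> for \<open>e + 1\<close>.\<close>
  define d where "d = n ^ 2 div (2 * b)"
  define e where "e = n ^ 2 div (4 * b)"
  define D where "D = n ^ 2 + m ^ 2 + n ^ 2"
  have dn: "2 * b * d \<le> n ^ 2" unfolding d_def by (rule times_div_less_eq_dividend)
  have en: "4 * b * e \<le> n ^ 2" unfolding e_def by (rule times_div_less_eq_dividend)
  have dn': "n ^ 2 < 2 * b * d + 2 * b" unfolding d_def
    using dividend_less_times_div[of "2 * b" "n ^ 2"] b(1) by (simp add: add.commute)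
  have en': "n ^ 2 < 4 * b * e + 4 * b" unfolding e_def
    using dividend_less_times_div[of "4 * b" "n ^ 2"] b(1) by (simp add: add.commute)
  have mb: "m ^ 2 \<le> b ^ 2 * n ^ 2" using power_mono[OF b(3), of 2] by (simp add: power_mult_distrib)
  have Dn: "D \<le> (2 + b ^ 2) * n ^ 2" using mb by (simp add: D_def algebra_simps)
  have D1: "D \<le> ?N * K"
  proof -
    have "2 * D \<le> 2 * 1 * (2 + b ^ 2) * n ^ 2" using Dn by simp
    also have "\<dots> \<le> 2 * b * (2 + b ^ 2) * n ^ 2" using b(1) by (intro mult_le_mono) auto
    also have "\<dots> = K * (n * n)" by (simp add: K_def power2_eq_square)
    also have "\<dots> \<le> K * (n * (n + 1))" by simp
    also have "\<dots> = 2 * (?N * K)" using arg_cong[OF two_N, of "\<lambda>x. K * x"] by (simp only: mult_ac)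
    finally show ?thesis by simp
  qed
  \<comment> \<open>The value of \<open>K\<close> comes from here: \<open>n \<le> b * m\<close> and
    \<open>n \<le> 2 * (n - 2 * K)\<close> put the factors \<open>b\<close> and 2 in front of
    \<open>2 + b ^ 2\<close>.\<close>
  have D2: "D \<le> m * (K * (n - 2 * K))"
  proof -
    note Dn
    also have "(2 + b ^ 2) * n ^ 2 = n * ((2 + b ^ 2) * n)" by (simp only: power2_eq_square[of n] mult_ac)
    also have "\<dots> \<le> (b * m) * ((2 + b ^ 2) * (2 * (n - 2 * K)))"
      using b(2) nK by (intro mult_le_mono) auto
    also have "\<dots> = m * (K * (n - 2 * K))" by (simp only: K_def mult_ac)
    finally show ?thesis .
  qed
  have nn: "n ^ 2 \<le> b * m * n" using b(2) by (simp add: power2_eq_square)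
  have d1: "d \<le> ?N"
  proof -
    have "2 * d \<le> 2 * b * d" using b(1) by simp
    also have "\<dots> \<le> n * n" using dn by (simp add: power2_eq_square)
    also have "\<dots> \<le> 2 * ?N" unfolding two_N by simp
    finally show ?thesis by simp
  qed
  have d2: "d \<le> m * (n - 2)"
  proof -
    have "2 * b * d \<le> b * m * n" using dn nn by (rule order_trans)
    also have "\<dots> \<le> b * m * (2 * (n - 2))" using n16 by (intro mult_le_mono2) simp
    finally have "2 * b * d \<le> 2 * b * (m * (n - 2))" by (simp add: mult_ac)
    then show ?thesis using b(1) by simp
  qed
  have d3: "d \<le> min (n choose 2) n * m"
  proof -
    have "2 * n \<le> n * (n - 1)" using n16 by simp
    then have "n \<le> n choose 2" using two_C by linarith
    then have "min (n choose 2) n = n" by simp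
    moreover have "d \<le> n * m"
      unfolding mult.commute[of n m] using d2 by (rule order_trans) (rule mult_le_mono2, simp)
    ultimately show ?thesis by (simp only:)
  qed
  have dNm: "d \<le> ?N * m" using d3 by (rule order_trans) (intro mult_le_mono1, simp)
  have DNm: "D \<le> ?N * m"
  proof -
    note D2
    also have "m * (K * (n - 2 * K)) \<le> m * (n choose 2)"
      using nK K by (intro mult_le_mono2 mult_diff_le_choose_two) linarith
    also have "\<dots> \<le> ?N * m" by (simp add: algebra_simps)
    finally show ?thesis .
  qed
  have n_sq: "16 * b + 16 * b * K * (1 + b) * n \<le> n ^ 2"
  proof -
    have "16 * b + 16 * b * K * (1 + b) * n \<le> (16 * b + 16 * b * K * (1 + b)) * n"
      using mult_le_mono2[of 1 n "16 * b"] n16 by (simp only: distrib_right) linarith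
    also have "\<dots> \<le> n * n" using n by (rule mult_le_mono1)
    finally show ?thesis by (simp add: power2_eq_square)
  qed
  \<comment> \<open>After multiplication by \<open>4 * b\<close> the left side is at most
    \<open>n ^ 2\<close> plus terms linear in \<open>n\<close>, and the right side is nearly
    \<open>2 * n ^ 2\<close>; \<open>n_sq\<close> absorbs the linear terms and the rounding.\<close>
  have ed: "2 + 4 * K * (n + m) + (e + 1) \<le> d"
  proof -
    have "16 * b * K * (n + m) \<le> 16 * b * K * ((1 + b) * n)"
      using b(3) by (intro mult_le_mono2) simp
    also have "\<dots> = 16 * b * K * (1 + b) * n" by (simp only: mult.assoc)
    finally have "16 * b * K * (n + m) \<le> 16 * b * K * (1 + b) * n" .
    moreover have "4 * b * (2 + 4 * K * (n + m) + (e + 1)) = 12 * b + 16 * b * K * (n + m) + 4 * b * e"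
      by (simp add: algebra_simps)
    ultimately have "4 * b * (2 + 4 * K * (n + m) + (e + 1)) \<le> 4 * b * d"
      using en dn' n_sq by linarith
    then show ?thesis unfolding mult_le_cancel1 using b(1) by simp
  qed
  have eD: "n ^ 2 + m ^ 2 + (e + 1) \<le> D"
  proof -
    have "4 * e \<le> 4 * b * e" using b(1) by simp
    then have "4 * e \<le> n ^ 2" using en by linarith
    moreover have "16 \<le> n ^ 2" using n16 self_le_power[of n 2] by linarith
    ultimately show ?thesis by (simp add: D_def)
  qed
  let ?M = "?N * m"
  have join: "?q ^ x * ?q ^ (?M - y) \<le> ?q ^ (?M - (e + 1))" if "x + (e + 1) \<le> y" "y \<le> ?M" for x y
    unfolding power_add[symmetric] using that q2 by (intro power_increasing) linarith+
  have "g_tensor ty n m * (order (GL ty n) * order (GL ty m))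
      \<le> ?q ^ ?M + ?q ^ (2 + 4 * K * (n + m)) * ?q ^ (?M - d) + ?q ^ (n ^ 2 + m ^ 2) * ?q ^ (?M - D)"
    unfolding g_tensor_burnside
    using n16 nK K by (intro sum_card_fixXW_le D1 D2 d1 d2 d3) linarith+
  also have "\<dots> \<le> ?q ^ ?M + (?q ^ (?M - (e + 1)) + ?q ^ (?M - (e + 1)))"
    using join[OF ed dNm] join[OF eD DNm] by simp
  \<comment> \<open>The 1 in \<open>e + 1\<close> lets two equal error terms fit into one power, as
    \<open>2 \<le> ?q\<close>.\<close>
  also have "\<dots> \<le> ?q ^ ?M + ?q ^ (?M - e)"
  proof -
    have "?M - e = Suc (?M - (e + 1))" using ed dNm by linarith
    then show ?thesis using mult_le_mono1[OF q2, of "?q ^ (?M - (e + 1))"]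
      by (simp only: power_Suc mult_2 add_le_cancel_left)
  qed
  finally have "real (g_tensor ty n m * (order (GL ty n) * order (GL ty m))) \<le> real (?q ^ ?M + ?q ^ (?M - e))"
    by (rule of_nat_mono)
  then have "real (g_tensor ty n m) * (real (order (GL ty n)) * real (order (GL ty m)))
      \<le> real ?q ^ ?M + real ?q ^ (?M - e)" by simp
  also have "real ?q ^ (?M - e) = real ?q ^ ?M * real ?q powr (- real e)"
  proof -
    have "e \<le> ?M" using ed dNm by linarith
    then show ?thesis using q2 by (simp add: power_diff powr_minus powr_realpow divide_inverse)
  qed
  finally have *: "real (g_tensor ty n m) * (real (order (GL ty n)) * real (order (GL ty m)))
      \<le> real ?q ^ ?M + real ?q ^ ?M * real ?q powr (- real e)" .
  \<comment> \<open>Halving \<open>n ^ 2 / (4 * b)\<close> absorbs the rounding in \<open>e\<close>,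
    because \<open>8 * b \<le> n ^ 2\<close>.\<close>
  have "real ?q powr (- real e) \<le> real ?q powr (- (1 / (8 * real b)) * real n ^ 2)"
  proof (rule powr_mono)
    have "8 * b \<le> n ^ 2" using n_sq by linarith
    then have "n ^ 2 \<le> 8 * b * e" using en' by linarith
    then have "real (n ^ 2) \<le> real (8 * b * e)" by (rule of_nat_mono)
    then show "- real e \<le> - (1 / (8 * real b)) * real n ^ 2" using b(1) by (simp add: field_simps)
  qed (use q2 in simp)
  then have "real ?q ^ ?M * real ?q powr (- real e)
      \<le> real ?q ^ ?M * real ?q powr (- (1 / (8 * real b)) * real n ^ 2)"
    by (rule mult_left_mono) simp
  with * show ?thesis unfolding distrib_left mult_1_right
    by (rule order_trans[OF _ add_left_mono])
qed

theorem theorem4p3: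
  fixes C R :: rat and q :: nat
  assumes "q = CARD('a::{field, finite})" and "C > 0"
  shows "\<exists>c::real. c > 0 \<and> (\<exists>n\<^sub>0. \<forall>n\<ge>n\<^sub>0.
    let m = nat \<lceil>C * of_nat n + R\<rceil>;
        GLV = real (order (GL TYPE('a) n));
        GLW = real (order (GL TYPE('a) m));
        K = real q ^ (m ^ 2) / GLW
    in real (g_tensor TYPE('a) n m)
         \<le> (real q - 1 + real q powr (- c * real n ^ 2))
           * (real q ^ (((n choose 2) + n) * m) / (GLV * GLW))
     \<and> real (g_Gr TYPE('a) n m)
         \<le> K * (real q - 1 + real q powr (- c * real n ^ 2))
           * (real (card (Gr n m :: 'a bivec set set)) / GLV))"
proof -
  have q2: "2 \<le> q" unfolding assms(1)
    using card_mono[of "UNIV :: 'a set" "{0,1}"] by simp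
  \<comment> \<open>The bound \<open>2 / C\<close> will yield \<open>n \<le> b * m\<close>, and
    \<open>C + 1\<close> will yield \<open>m \<le> b * n\<close>.\<close>
  define b where "b = max 1 (nat \<lceil>max (2 / C) (C + 1)\<rceil>)"
  define c where "c = 1 / (8 * real b)"
  \<comment> \<open>The first part is the threshold of \<open>g_tensor_upper\<close>; the others
    make the absolute value of \<open>R\<close> at most \<open>C * n / 2\<close> and at most
    \<open>n - 1\<close>.\<close>
  define n0 where "n0 = 16 * b + 16 * b * (2 * b * (2 + b ^ 2)) * (1 + b)
    + nat \<lceil>2 * \<bar>R\<bar> / C\<rceil> + nat \<lceil>\<bar>R\<bar> + 1\<rceil>"
  have b1: "1 \<le> b" by (simp add: b_def)
  have "max (2 / C) (C + 1) \<le> of_nat (nat \<lceil>max (2 / C) (C + 1)\<rceil>)" by (rule of_nat_ceiling)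
  also have "\<dots> \<le> of_nat b" by (rule of_nat_mono) (simp add: b_def)
  finally have b2: "2 / C \<le> of_nat b" "C + 1 \<le> of_nat b" by simp_all
  have main: "real (g_tensor TYPE('a) n m)
         \<le> (real q - 1 + real q powr (- c * real n ^ 2))
           * (real q ^ (((n choose 2) + n) * m) / (real (order (GL TYPE('a) n)) * real (order (GL TYPE('a) m))))
     \<and> real (g_Gr TYPE('a) n m)
         \<le> real q ^ (m ^ 2) / real (order (GL TYPE('a) m)) * (real q - 1 + real q powr (- c * real n ^ 2))
           * (real (card (Gr n m :: 'a bivec set set)) / real (order (GL TYPE('a) n)))"
    if n: "n0 \<le> n" and m: "m = nat \<lceil>C * of_nat n + R\<rceil>" for n m
  proof -
    let ?N = "(n choose 2) + n" and ?GV = "real (order (GL TYPE('a) n))"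
      and ?GW = "real (order (GL TYPE('a) m))"
    let ?\<epsilon> = "real q - 1 + real q powr (- c * real n ^ 2)"
    have nb: "16 * b + 16 * b * (2 * b * (2 + b ^ 2)) * (1 + b) \<le> n"
      and nR: "nat \<lceil>2 * \<bar>R\<bar> / C\<rceil> \<le> n" "nat \<lceil>\<bar>R\<bar> + 1\<rceil> \<le> n" using n by (simp_all add: n0_def)
    have R1: "2 * \<bar>R\<bar> / C \<le> of_nat n"
      using order_trans[OF of_nat_ceiling of_nat_mono[OF nR(1)]] .
    have R2: "\<bar>R\<bar> + 1 \<le> of_nat n"
      using order_trans[OF of_nat_ceiling of_nat_mono[OF nR(2)]] .
    have "2 * \<bar>R\<bar> \<le> C * of_nat n" using R1 assms(2) by (simp add: pos_divide_le_eq mult.commute)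
    then have half: "C * of_nat n \<le> 2 * (C * of_nat n) + 2 * R"
      using abs_ge_minus_self[of R] by linarith
    moreover have "0 \<le> C * of_nat n" using assms(2) by simp
    \<comment> \<open>Hence the ceiling is nonnegative and \<open>nat\<close> does not change
      it.\<close>
    ultimately have "0 \<le> C * of_nat n + R" by linarith
    from ceiling_mono[OF this] have m_of: "(of_nat m :: rat) = of_int \<lceil>C * of_nat n + R\<rceil>"
      by (simp add: m)
    have m_ge: "C * of_nat n \<le> 2 * of_nat m"
      using half m_of le_of_int_ceiling[of "C * of_nat n + R"] by linarith
    have "of_nat m \<le> C * of_nat n + of_nat n"
      using R2 abs_ge_self[of R] m_of of_int_ceiling_le_add_one[of "C * of_nat n + R"]
      by linarith
    then have m_le: "of_nat m \<le> (C + 1) * of_nat n" by (simp add: distrib_right)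
    have nm: "n \<le> b * m"
    proof -
      have "(of_nat n :: rat) = C * of_nat n / C" using assms(2) by simp
      also have "\<dots> \<le> 2 * of_nat m / C" using m_ge assms(2) by (intro divide_right_mono) auto
      also have "\<dots> = 2 / C * of_nat m" by simp
      also have "\<dots> \<le> of_nat b * of_nat m" using b2(1) by (intro mult_right_mono) auto
      finally have "(of_nat n :: rat) \<le> of_nat (b * m)" by simp
      then show ?thesis by (simp only: of_nat_le_iff)
    qed
    have mn: "m \<le> b * n"
    proof -
      note m_le
      also have "(C + 1) * of_nat n \<le> of_nat b * of_nat n" using b2(2) by (intro mult_right_mono) auto
      finally have "(of_nat m :: rat) \<le> of_nat (b * n)" by simp
      then show ?thesis by (simp only: of_nat_le_iff)
    qed
    have pos: "0 < ?GV" "0 < ?GW" using order_GL_pos by simp_all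
    have "real (g_tensor TYPE('a) n m) * (?GV * ?GW)
        \<le> real q ^ (?N * m) * (1 + real q powr (- c * real n ^ 2))"
      using g_tensor_upper[OF b1 nm mn nb, of "TYPE('a)"] by (simp add: assms(1) c_def)
    \<comment> \<open>The estimate has leading factor 1, and \<open>1 \<le> q - 1\<close>.\<close>
    also have "\<dots> \<le> real q ^ (?N * m) * ?\<epsilon>" using q2 by (intro mult_left_mono) auto
    finally have T: "real (g_tensor TYPE('a) n m) \<le> ?\<epsilon> * (real q ^ (?N * m) / (?GV * ?GW))"
      using pos_le_divide_eq[OF mult_pos_pos[OF pos]] by (simp add: mult.commute)
    have mN: "m \<le> ?N"
    proof -
      have "2 * b \<le> n" using nb by linarith
      have "2 * m \<le> 2 * b * n" using mn by simp
      also have "\<dots> \<le> n * n" using \<open>2 * b \<le> n\<close> by (rule mult_le_mono1)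
      also have "\<dots> \<le> 2 * ?N" by (cases n) (simp_all add: distrib_left two_times_choose_two)
      finally show ?thesis by simp
    qed
    obtain z where z: "?N = m + z" using mN by (auto simp: le_iff_add)
    \<comment> \<open>Splitting off \<open>q ^ (m ^ 2)\<close> leaves the lower bound for the
      Grassmannian; divided by the order of GL(W), this power is the factor \<open>K\<close> of the
      theorem.\<close>
    have "q ^ (?N * m) = q ^ (m ^ 2) * q ^ ((?N - m) * m)"
      by (simp add: z power2_eq_square distrib_right power_add)
    also have "\<dots> \<le> q ^ (m ^ 2) * card (Gr n m :: 'a bivec set set)"
      unfolding assms(1) by (intro mult_le_mono2 card_Gr_ge mN)
    finally have "real (q ^ (?N * m)) \<le> real (q ^ (m ^ 2) * card (Gr n m :: 'a bivec set set))"
      by (rule of_nat_mono)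
    then have Gr: "real q ^ (?N * m) \<le> real q ^ (m ^ 2) * real (card (Gr n m :: 'a bivec set set))"
      by simp
    have "real (g_Gr TYPE('a) n m) \<le> real (g_tensor TYPE('a) n m)"
      by (rule of_nat_mono[OF g_Gr_le_g_tensor])
    also note T
    also have "?\<epsilon> * (real q ^ (?N * m) / (?GV * ?GW))
        \<le> ?\<epsilon> * (real q ^ (m ^ 2) * real (card (Gr n m :: 'a bivec set set)) / (?GV * ?GW))"
      using Gr pos q2 by (intro mult_left_mono divide_right_mono) auto
    also have "\<dots> = real q ^ (m ^ 2) / ?GW * ?\<epsilon> * (real (card (Gr n m :: 'a bivec set set)) / ?GV)"
      by (simp add: field_simps)
    finally show ?thesis using T by simp
  qed
  have "0 < c" using b1 by (simp add: c_def)
  with main show ?thesis unfolding Let_def by (intro exI[of _ c] conjI exI[of _ n0] allI impI) auto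
qed

end
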